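(* Let $T$ be a finite rooted tree, $S$ an adequate partial semigroup, and $\alpha$ an action of $T$ on $S$ (given by $t\mapsto S_t$ and $\mathcal F_\alpha\subseteq\mathrm{End}(S)$) such that the spine $f_\tau$ of every $\tau\in\mathcal F_\alpha$ is a regressive homomorphism. The following are equivalent: (1) $\alpha$ is Ramsey; (2) the action induced by $\alpha$ on $\gamma S$ is Ramsey, i.e. $(\gamma S)_\alpha\neq\emptyset$; (3) for every finite coloring $c$ of $S$, every sequence of functions $\psi^{(\mathcal F)}_n:(S^T)^n\to[\mathcal F_\alpha]^{<\aleph_0}$ and every sequence of functions $\psi^{(S)}_n:(S^T)^n\to[S]^{<\aleph_0}$ ($n\in\omega$) such that $\psi^{(S)}_n(x_0,\dots,x_{n-1})$ contains the range of $\tau_i\circ x_i$ for all $i<n$ and $\tau_i\in\psi^{(\mathcal F)}_i(x_0,\dots,x_{i-1})$, there exist functions $x_n:T\to S$ ($n\in\omega$) such that $x_n(t)\in S_t\cap\varphi_S(\psi^{(S)}_n(x_0,\dots,x_{n-1}))$ for all $n,t$, and for every $\ell\in\omega$, $n_0<n_1<\cdots<n_\ell$, $t_i\in T$ and $\tau_i\in\psi^{(\mathcal F)}_{n_i}(x_0,\dots,x_{n_i-1})$ ($i\le\ell$), if $\{f_{\tau_i}(t_i):i\le\ell\}$ is a chain in $T$ with least element $t$, then the color of $\tau_0(x_{n_0}(t_0))+\cdots+\tau_\ell(x_{n_\ell}(t_\ell))$ depends only on $t$.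
   Context: Finite rooted tree $T$: ordered by $t'\le t$ iff $t'$ is a descendant of $t$ or equal to it. A regressive homomorphism is $f:T\to T$ with $f(t)\ge t$ for all $t$, mapping adjacent nodes to the same node or adjacent nodes. $\omega=\{0,1,\dots\}$, $[A]^{<\aleph_0}$ = finite subsets of $A$. Partial semigroups: set $S$ with partial associative operation (one side of $(x+y)+z=x+(y+z)$ defined iff the other is). $\varphi_S(A)=\{x: a+x\text{ defined }\forall a\in A\}$; $S$ adequate if $\varphi_S(A)\ne\emptyset$ for all finite $A$. Homomorphisms satisfy $f(x+y)=f(x)+f(y)$ in the same sense; adequate if for each finite $B$ there is finite $A$ with $f(\varphi(A))\subseteq\varphi(B)$. Adequate partial subsemigroup: subset closed under $+$ with the inclusion adequate; ordered by $S_0\le S_1$ iff $s_0+s_1,s_1+s_0\in S_0$ whenever defined ($s_i\in S_i$). $\mathrm{End}(S)$: adequate homomorphisms $S\to S$. An action $\alpha$ of $T$ on $S$: order-preserving $t\mapsto S_t$ into adequate partial subsemigroups and a subsemigroup $\mathcal F_\alpha\subseteq\mathrm{End}(S)$, each $\tau$ with a spine $f_\tau:T\to T$ such that $\tau(S_t)\subseteq S_{f_\tau(t)}$ and $\tau(s)=s$ when $s\in S_t$, $f_\tau(t)=t$. The action is Ramsey if all spines are regressive homomorphisms and for every finite $S_0\subseteq S$, finite coloring $c$ of $S$ and finite $\mathcal F_0\subseteq\mathcal F_\alpha$, there is $x:T\to S$ with $x(t)\in S_t\cap\varphi_S(S_0)$ for all $t$ and such that for $\tau\in\mathcal F_0$,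 $t\in T$, the color of $\tau(x(t))$ depends only on $f_\tau(t)$. $\gamma S$: ultrafilters $\mathcal U$ on $S$ with $\{y:x+y\text{ defined}\}\in\mathcal U$ for all $x$; compact right topological semigroup with $A\in\mathcal U+\mathcal V$ iff $\{x:\{y:x+y\in A\}\in\mathcal V\}\in\mathcal U$. Each $\tau\in\mathrm{End}(S)$ extends to a continuous homomorphism of $\gamma S$ ($A\in\tau(\mathcal U)$ iff $\tau^{-1}(A)\in\mathcal U$); $\gamma S_t=\{\mathcal U\in\gamma S:S_t\in\mathcal U\}$. $(\gamma S)_\alpha$ is the set of $\xi:T\to\gamma S$ with $\xi(t)\in\gamma S_t$ and $\tau\circ\xi=\xi\circ f_\tau$ for all $\tau\in\mathcal F_\alpha$.
   Formalization: Added: either the identity is in F_α with identity spine, or f_{σ∘τ}=f_σ∘f_τ for all σ,τ in F_α. Regressive homomorphisms must send each node and its parent to one node or to a node and its parent (so preserve order). Without these the equivalence fails. *)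

theory Defs
  imports Main
begin

section \<open>Partial semigroups\<close>

text \<open>
  A partial operation is a function into the option type; the value \<open>None\<close> means "undefined".
  Most notions are relative to a carrier \<open>C\<close>, so that subsets of a partial semigroup can
  themselves be regarded as partial semigroups under the restricted operation.
\<close>

type_synonym 's pop = "'s \<Rightarrow> 's \<Rightarrow> 's option"

definition closed_under :: "'s set \<Rightarrow> 's pop \<Rightarrow> bool" where
  "closed_under C add \<longleftrightarrow> (\<forall>x\<in>C. \<forall>y\<in>C. \<forall>z. add x y = Some z \<longrightarrow> z \<in> C)"

text \<open>Equality of options in the associative law says: one side is defined iff the other is.\<close>

definition partial_semigroup :: "'s set \<Rightarrow> 's pop \<Rightarrow> bool" where
  "partial_semigroup C add \<longleftrightarrow> closed_under C add \<and>
     (\<forall>x\<in>C. \<forall>y\<in>C. \<forall>z\<in>C.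
        Option.bind (add x y) (\<lambda>u. add u z) = Option.bind (add y z) (\<lambda>v. add x v))"

definition phi :: "'s set \<Rightarrow> 's pop \<Rightarrow> 's set \<Rightarrow> 's set" where
  "phi C add A = {x \<in> C. \<forall>a\<in>A. add a x \<noteq> None}"

definition adequate :: "'s set \<Rightarrow> 's pop \<Rightarrow> bool" where
  "adequate C add \<longleftrightarrow> partial_semigroup C add \<and>
     (\<forall>A. finite A \<longrightarrow> A \<subseteq> C \<longrightarrow> phi C add A \<noteq> {})"

definition partial_hom :: "'s set \<Rightarrow> 's pop \<Rightarrow> 'r set \<Rightarrow> 'r pop \<Rightarrow> ('s \<Rightarrow> 'r) \<Rightarrow> bool" where
  "partial_hom C add D add' h \<longleftrightarrow> h ` C \<subseteq> D \<and>
     (\<forall>x\<in>C. \<forall>y\<in>C. map_option h (add x y) = add' (h x) (h y))"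

definition adequate_hom :: "'s set \<Rightarrow> 's pop \<Rightarrow> 'r set \<Rightarrow> 'r pop \<Rightarrow> ('s \<Rightarrow> 'r) \<Rightarrow> bool" where
  "adequate_hom C add D add' h \<longleftrightarrow> partial_hom C add D add' h \<and>
     (\<forall>B. finite B \<longrightarrow> B \<subseteq> D \<longrightarrow>
        (\<exists>A. finite A \<and> A \<subseteq> C \<and> h ` phi C add A \<subseteq> phi D add' B))"

definition adequate_partial_subsemigroup :: "'s pop \<Rightarrow> 's set \<Rightarrow> bool" where
  "adequate_partial_subsemigroup add C \<longleftrightarrow>
     closed_under C add \<and> adequate_hom C add UNIV add id"

definition subsemigroup_le :: "'s pop \<Rightarrow> 's set \<Rightarrow> 's set \<Rightarrow> bool" where
  "subsemigroup_le add A B \<longleftrightarrow>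
     (\<forall>a\<in>A. \<forall>b\<in>B. \<forall>z. add a b = Some z \<or> add b a = Some z \<longrightarrow> z \<in> A)"

definition End :: "'s pop \<Rightarrow> ('s \<Rightarrow> 's) set" where
  "End add = {\<tau>. adequate_hom UNIV add UNIV add \<tau>}"

text \<open>The sum of a nonempty list; it is defined iff all partial sums are.\<close>

fun psum :: "'s pop \<Rightarrow> 's list \<Rightarrow> 's option" where
  "psum add [] = None"
| "psum add (x # xs) = foldl (\<lambda>acc y. Option.bind acc (\<lambda>a. add a y)) (Some x) xs"

section \<open>Finite rooted trees\<close>

text \<open>
  The nodes of a finite rooted tree are the elements of a finite type; the tree is given by its
  root and the parent map, where by convention the root is its own parent.
\<close>

definition rooted_tree :: "'t::finite \<Rightarrow> ('t \<Rightarrow> 't) \<Rightarrow> bool" where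
  "rooted_tree r par \<longleftrightarrow> par r = r \<and> (\<forall>t. \<exists>n. (par ^^ n) t = r)"

text \<open>The root is the largest element.\<close>

definition tree_le :: "('t \<Rightarrow> 't) \<Rightarrow> 't \<Rightarrow> 't \<Rightarrow> bool" where
  "tree_le par t' t \<longleftrightarrow> (\<exists>n. (par ^^ n) t' = t)"

definition child_of :: "('t \<Rightarrow> 't) \<Rightarrow> 't \<Rightarrow> 't \<Rightarrow> bool" where
  "child_of par t' t \<longleftrightarrow> t' \<noteq> t \<and> par t' = t"

text \<open>
  Adjacency is read as the edge relation of the rooted tree, directed from a node to its parent.
  Thus a homomorphism maps a node and its parent to the same node, or to a node and its parent; in
  particular it is monotone.  With undirected edges a regressive map could send a node strictly
  above the image of its parent.
\<close>

definition regressive_hom :: "('t \<Rightarrow> 't) \<Rightarrow> ('t \<Rightarrow> 't) \<Rightarrow> bool" where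
  "regressive_hom par h \<longleftrightarrow> (\<forall>t. tree_le par t (h t)) \<and>
     (\<forall>t' t. child_of par t' t \<longrightarrow> h t' = h t \<or> child_of par (h t') (h t))"

section \<open>Actions of a tree on a partial semigroup\<close>

text \<open>
  \<open>St t\<close> is the subsemigroup attached to \<open>t\<close>, \<open>F\<close> is the semigroup of endomorphisms, and
  \<open>f \<tau>\<close> is the spine of \<open>\<tau>\<close> (irrelevant for \<open>\<tau>\<close> outside \<open>F\<close>).  If the sets \<open>St t\<close>
  overlap, \<open>\<tau>\<close> may admit several spines, so that \<open>f\<close> is a choice; compatibility of this choice
  with composition is not part of the definition.
\<close>

definition tree_action ::
  "('t::finite \<Rightarrow> 't) \<Rightarrow> 's pop \<Rightarrow> ('t \<Rightarrow> 's set) \<Rightarrow> ('s \<Rightarrow> 's) set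
     \<Rightarrow> (('s \<Rightarrow> 's) \<Rightarrow> 't \<Rightarrow> 't) \<Rightarrow> bool" where
  "tree_action par add St F f \<longleftrightarrow>
     (\<forall>t. adequate_partial_subsemigroup add (St t)) \<and>
     (\<forall>t' t. tree_le par t' t \<longrightarrow> subsemigroup_le add (St t') (St t)) \<and>
     F \<subseteq> End add \<and> (\<forall>\<sigma>\<in>F. \<forall>\<tau>\<in>F. \<sigma> \<circ> \<tau> \<in> F) \<and>
     (\<forall>\<tau>\<in>F. \<forall>t. \<tau> ` St t \<subseteq> St (f \<tau> t) \<and> (f \<tau> t = t \<longrightarrow> (\<forall>s\<in>St t. \<tau> s = s)))"

definition ramsey_action ::
  "('t::finite \<Rightarrow> 't) \<Rightarrow> 's pop \<Rightarrow> ('t \<Rightarrow> 's set) \<Rightarrow> ('s \<Rightarrow> 's) set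
     \<Rightarrow> (('s \<Rightarrow> 's) \<Rightarrow> 't \<Rightarrow> 't) \<Rightarrow> bool" where
  "ramsey_action par add St F f \<longleftrightarrow>
     (\<forall>\<tau>\<in>F. regressive_hom par (f \<tau>)) \<and>
     (\<forall>S0 (c :: 's \<Rightarrow> nat) F0. finite S0 \<longrightarrow> finite (range c) \<longrightarrow> finite F0 \<longrightarrow> F0 \<subseteq> F \<longrightarrow>
        (\<exists>x :: 't \<Rightarrow> 's. (\<forall>t. x t \<in> St t \<inter> phi UNIV add S0) \<and>
           (\<exists>g :: 't \<Rightarrow> nat. \<forall>\<tau>\<in>F0. \<forall>t. c (\<tau> (x t)) = g (f \<tau> t))))"

section \<open>The induced action on ultrafilters\<close>

definition is_ultrafilter :: "'s filter \<Rightarrow> bool" where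
  "is_ultrafilter U \<longleftrightarrow> U \<noteq> bot \<and> (\<forall>P. eventually P U \<or> eventually (\<lambda>s. \<not> P s) U)"

definition gammaS :: "'s pop \<Rightarrow> 's filter set" where
  "gammaS add = {U. is_ultrafilter U \<and> (\<forall>x. eventually (\<lambda>y. add x y \<noteq> None) U)}"

definition gamma_sub :: "'s pop \<Rightarrow> 's set \<Rightarrow> 's filter set" where
  "gamma_sub add C = {U \<in> gammaS add. eventually (\<lambda>s. s \<in> C) U}"

text \<open>The extension of \<open>\<tau>\<close> to ultrafilters is \<^term>\<open>filtermap \<tau>\<close>.\<close>

definition gamma_action ::
  "'s pop \<Rightarrow> ('t::finite \<Rightarrow> 's set) \<Rightarrow> ('s \<Rightarrow> 's) set \<Rightarrow> (('s \<Rightarrow> 's) \<Rightarrow> 't \<Rightarrow> 't)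
     \<Rightarrow> ('t \<Rightarrow> 's filter) set" where
  "gamma_action add St F f =
     {\<xi>. (\<forall>t. \<xi> t \<in> gamma_sub add (St t)) \<and> (\<forall>\<tau>\<in>F. filtermap \<tau> \<circ> \<xi> = \<xi> \<circ> f \<tau>)}"

section \<open>The infinitary Ramsey statement\<close>

text \<open>
  A sequence of functions on the powers \<open>(S\<^sup>T)\<^sup>n\<close> is a single function on lists of maps
  from \<open>T\<close> to \<open>S\<close>, the length of the list being \<open>n\<close>.
\<close>

definition admissible ::
  "('s \<Rightarrow> 's) set \<Rightarrow> (('t::finite \<Rightarrow> 's) list \<Rightarrow> ('s \<Rightarrow> 's) set) \<Rightarrow> (('t \<Rightarrow> 's) list \<Rightarrow> 's set) \<Rightarrow> bool"
where
  "admissible F \<psi>F \<psi>S \<longleftrightarrow>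
     (\<forall>xs. finite (\<psi>F xs) \<and> \<psi>F xs \<subseteq> F) \<and> (\<forall>xs. finite (\<psi>S xs)) \<and>
     (\<forall>xs. \<forall>i<length xs. \<forall>\<tau>\<in>\<psi>F (take i xs). range (\<tau> \<circ> xs ! i) \<subseteq> \<psi>S xs)"

text \<open>
  The colour of a sum depends only on the least element of the chain: it is \<open>g\<close> of it.  That the
  sum is defined is part of the assertion.
\<close>

definition infinitary_ramsey ::
  "('t::finite \<Rightarrow> 't) \<Rightarrow> 's pop \<Rightarrow> ('t \<Rightarrow> 's set) \<Rightarrow> ('s \<Rightarrow> 's) set
     \<Rightarrow> (('s \<Rightarrow> 's) \<Rightarrow> 't \<Rightarrow> 't) \<Rightarrow> bool" where
  "infinitary_ramsey par add St F f \<longleftrightarrow>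
     (\<forall>(c :: 's \<Rightarrow> nat) \<psi>F \<psi>S. finite (range c) \<longrightarrow> admissible F \<psi>F \<psi>S \<longrightarrow>
       (\<exists>x :: nat \<Rightarrow> 't \<Rightarrow> 's.
          (\<forall>n t. x n t \<in> St t \<inter> phi UNIV add (\<psi>S (map x [0..<n]))) \<and>
          (\<exists>g :: 't \<Rightarrow> nat. \<forall>(l::nat) (n :: nat \<Rightarrow> nat) (ts :: nat \<Rightarrow> 't) (\<tau>s :: nat \<Rightarrow> 's \<Rightarrow> 's) t.
             (\<forall>i<l. n i < n (Suc i)) \<longrightarrow>
             (\<forall>i\<le>l. \<tau>s i \<in> \<psi>F (map x [0..<n i])) \<longrightarrow>
             (\<forall>i\<le>l. \<forall>j\<le>l. tree_le par (f (\<tau>s i) (ts i)) (f (\<tau>s j) (ts j)) \<or>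
                            tree_le par (f (\<tau>s j) (ts j)) (f (\<tau>s i) (ts i))) \<longrightarrow>
             (\<exists>i\<le>l. t = f (\<tau>s i) (ts i)) \<longrightarrow>
             (\<forall>i\<le>l. tree_le par t (f (\<tau>s i) (ts i))) \<longrightarrow>
             (\<exists>s. psum add (map (\<lambda>i. \<tau>s i (x (n i) (ts i))) [0..<Suc l]) = Some s \<and> c s = g t))))"

end

theory Submission
  imports Defs "HOL-Library.Nat_Bijection"
begin

text \<open>
  The limit of witnesses \<open>x : T \<rightarrow> S\<close> of the Ramsey property along an ultrafilter that
  contains all the sets of witnesses is, up to a correction on the images of the spines, a point of
  \<open>(\<gamma>S)\<^sub>\<alpha>\<close>.  Conversely \<open>(\<gamma>S)\<^sub>\<alpha>\<close> is a compact right topological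
  semigroup under pointwise addition, so Ellis' lemma gives a point \<open>\<xi>\<close> with idempotent values.
  Sums of these values along the paths to the root stay in \<open>(\<gamma>S)\<^sub>\<alpha>\<close>, because regressive
  homomorphisms map such paths to paths with repetitions; treating the levels of the tree one
  by one, they lead to a \<open>\<xi>\<close> with \<open>\<xi> s + \<xi> t = \<xi> t + \<xi> s = \<xi> s\<close> for \<open>s \<le> t\<close>.  With this
  \<open>\<xi>\<close> the sequence \<open>x\<^sub>n\<close> is chosen recursively as in the Galvin--Glazer proof of
  Hindman's theorem, the colour of a sum being the one that is typical for \<open>\<xi>\<close> at its least node.
\<close>

section \<open>Ultrafilters and Ellis' lemma\<close>

text \<open>Zorn's lemma for the reversed order. The empty chain is bounded by any element of
  \<open>A\<close>, so \<open>lower\<close> speaks of nonempty chains.\<close>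

lemma chain_minimal_exists:
  fixes A :: "'a::order set"
  assumes "A \<noteq> {}"
    and lower: "\<And>C. C \<subseteq> A \<Longrightarrow> C \<noteq> {} \<Longrightarrow> (\<And>a b. a \<in> C \<Longrightarrow> b \<in> C \<Longrightarrow> a \<le> b \<or> b \<le> a)
       \<Longrightarrow> \<exists>u\<in>A. \<forall>a\<in>C. u \<le> a"
  shows "\<exists>m\<in>A. \<forall>a\<in>A. a \<le> m \<longrightarrow> a = m"
proof (rule predicate_Zorn[of A "(\<ge>)"])
  show "partial_order_on A (relation_of (\<ge>) A)"
    by (auto simp: partial_order_on_def preorder_on_def refl_on_def trans_on_def antisym_on_def
        relation_of_def)
  fix C assume C: "C \<in> Chains (relation_of (\<ge>) A)"
  show "\<exists>u\<in>A. \<forall>a\<in>C. a \<ge> u"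
  proof (cases "C = {}")
    case False
    with C show ?thesis
      by (intro lower) (auto simp: Chains_def relation_of_def)
  qed (use \<open>A \<noteq> {}\<close> in auto)
qed

text \<open>A chain is a filter base. With \<open>P\<close> constantly false this shows that a
  nonempty chain of proper filters has a proper infimum.\<close>

lemma eventually_Inf_chain:
  assumes "C \<noteq> {}" and "\<And>F G. F \<in> C \<Longrightarrow> G \<in> C \<Longrightarrow> F \<le> G \<or> G \<le> F"
  shows "eventually P (Inf C) \<longleftrightarrow> (\<exists>F\<in>C. eventually P F)"
proof (rule eventually_Inf_base[OF assms(1)])
  fix F G assume "F \<in> C" "G \<in> C"
  moreover from assms(2)[OF this] have "F \<le> inf F G \<or> G \<le> inf F G"
    by auto
  ultimately show "\<exists>H\<in>C. H \<le> inf F G"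
    by blast
qed

text \<open>Smaller filters have more sets, so ultrafilters are the minimal filters different from
  \<open>bot\<close>; Zorn's lemma gives one below \<open>F\<close>.\<close>

lemma ultrafilter_exists:
  assumes "F \<noteq> bot"
  obtains U where "is_ultrafilter U" and "U \<le> F"
proof -
  let ?A = "{G. G \<noteq> bot \<and> G \<le> F}"
  have "\<exists>U\<in>?A. \<forall>G\<in>?A. G \<le> U \<longrightarrow> G = U"
  proof (rule chain_minimal_exists)
    fix C assume C: "C \<subseteq> ?A" "C \<noteq> {}"
      and chain: "\<And>a b. a \<in> C \<Longrightarrow> b \<in> C \<Longrightarrow> a \<le> b \<or> b \<le> a"
    have "Inf C \<noteq> bot"
      using C eventually_Inf_chain[OF C(2) chain, of "\<lambda>_. False"]
      by (auto simp: eventually_False)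
    moreover have "Inf C \<le> F"
      using C by (auto intro: Inf_lower2)
    ultimately show "\<exists>u\<in>?A. \<forall>a\<in>C. u \<le> a"
      by (auto intro: Inf_lower)
  qed (use assms in auto)
  then obtain U where U: "U \<noteq> bot" "U \<le> F"
    and min: "\<And>G. G \<noteq> bot \<Longrightarrow> G \<le> U \<Longrightarrow> G = U"
    by (auto intro: order_trans)
  \<comment> \<open>If adjoining the complement of \<open>P\<close> leaves the filter proper,
    minimality says that \<open>U\<close> contains it already; otherwise \<open>U\<close> contains
    \<open>P\<close>.\<close>
  have "eventually P U \<or> eventually (\<lambda>s. \<not> P s) U" for P
  proof (cases "inf U (principal {s. \<not> P s}) = bot")
    case True
    then have "eventually (\<lambda>_. False) (inf U (principal {s. \<not> P s}))"
      by simp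
    then show ?thesis
      by (simp add: eventually_inf_principal)
  next
    case False
    then have "inf U (principal {s. \<not> P s}) = U"
      by (intro min) auto
    moreover have "eventually (\<lambda>s. \<not> P s) (inf U (principal {s. \<not> P s}))"
      by (simp add: eventually_inf_principal)
    ultimately show ?thesis
      by simp
  qed
  with U that show thesis
    by (auto simp: is_ultrafilter_def)
qed

lemma ultrafilter_not:
  assumes "is_ultrafilter U"
  shows "eventually (\<lambda>s. \<not> P s) U \<longleftrightarrow> \<not> eventually P U"
proof
  assume "eventually (\<lambda>s. \<not> P s) U"
  then have "eventually (\<lambda>_. False) U" if "eventually P U"
    using that by eventually_elim auto
  with assms show "\<not> eventually P U"
    by (auto simp: is_ultrafilter_def eventually_False)
qed (use assms in \<open>auto simp: is_ultrafilter_def\<close>)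

lemma ultrafilter_filtermap: "is_ultrafilter U \<Longrightarrow> is_ultrafilter (filtermap h U)"
  by (simp add: is_ultrafilter_def eventually_filtermap filtermap_bot_iff)

lemma filtermap_cong_eventually:
  assumes "\<forall>\<^sub>F x in U. g x = h x"
  shows "filtermap g U = filtermap h U"
  unfolding filter_eq_iff eventually_filtermap
proof
  show "(\<forall>\<^sub>F x in U. P (g x)) \<longleftrightarrow> (\<forall>\<^sub>F x in U. P (h x))" for P
    using assms by (rule eventually_cong) simp
qed

lemma ultrafilter_finite_range:
  assumes "is_ultrafilter U" and "finite (range c)"
  shows "\<exists>v. eventually (\<lambda>s. c s = v) U"
proof (rule ccontr)
  assume "\<nexists>v. eventually (\<lambda>s. c s = v) U"
  then have "\<forall>v\<in>range c. eventually (\<lambda>s. c s \<noteq> v) U"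
    using ultrafilter_not[OF assms(1)] by auto
  then have "eventually (\<lambda>s. \<forall>v\<in>range c. c s \<noteq> v) U"
    using assms(2) by (intro eventually_ball_finite)
  then have "eventually (\<lambda>_. False) U"
    by eventually_elim auto
  with assms(1) show False
    by (auto simp: is_ultrafilter_def eventually_False)
qed

section \<open>Limits of ultrafilters, compactness and Ellis' lemma\<close>

text \<open>
  A compact topology enters only through the limits of its ultrafilters: a set is closed iff it
  contains the limit of every ultrafilter that it carries.
\<close>

definition lim_closed :: "('a filter \<Rightarrow> 'a) \<Rightarrow> 'a set \<Rightarrow> bool" where
  "lim_closed lm M \<longleftrightarrow> (\<forall>U. is_ultrafilter U \<longrightarrow> eventually (\<lambda>x. x \<in> M) U \<longrightarrow> lm U \<in> M)"

lemma lim_closedD: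
  "lim_closed lm M \<Longrightarrow> is_ultrafilter U \<Longrightarrow> eventually (\<lambda>x. x \<in> M) U \<Longrightarrow> lm U \<in> M"
  by (simp add: lim_closed_def)

text \<open>Compactness: the members of the chain generate a proper filter, and the limit of an
  ultrafilter below it lies in every member.\<close>

lemma lim_closed_chain_Inter:
  assumes "C \<noteq> {}" and "\<And>M. M \<in> C \<Longrightarrow> lim_closed lm M \<and> M \<noteq> {}"
    and chain: "\<And>M N. M \<in> C \<Longrightarrow> N \<in> C \<Longrightarrow> M \<subseteq> N \<or> N \<subseteq> M"
  shows "lim_closed lm (\<Inter>C) \<and> \<Inter>C \<noteq> {}"
proof -
  have "eventually P (INF M\<in>C. principal M) \<longleftrightarrow> (\<exists>M\<in>C. eventually P (principal M))" for P
    using assms(1) chain by (intro eventually_Inf_chain[of "principal ` C", simplified]) auto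
  from this[of "\<lambda>_. False"] have "(INF M\<in>C. principal M) \<noteq> bot"
    using assms(2) unfolding trivial_limit_def eventually_principal by auto
  then obtain U where U: "is_ultrafilter U" "U \<le> (INF M\<in>C. principal M)"
    by (rule ultrafilter_exists)
  have "eventually (\<lambda>x. x \<in> M) U" if "M \<in> C" for M
  proof -
    have "U \<le> principal M"
      using U(2) that by (meson INF_lower order_trans)
    then show ?thesis
      by (simp add: le_principal)
  qed
  then have "lm U \<in> \<Inter>C"
    using U(1) assms(2) by (auto intro: lim_closedD)
  moreover have "lim_closed lm (\<Inter>C)"
    unfolding lim_closed_def
  proof (intro allI impI InterI)
    fix U M assume U: "is_ultrafilter U" "\<forall>\<^sub>F x in U. x \<in> \<Inter>C" and "M \<in> C"
    from U(2) have "\<forall>\<^sub>F x in U. x \<in> M"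
      by eventually_elim (use \<open>M \<in> C\<close> in auto)
    then show "lm U \<in> M"
      using assms(2) \<open>M \<in> C\<close> U(1) by (auto intro: lim_closedD)
  qed
  ultimately show ?thesis
    by auto
qed

text \<open>For \<open>e\<close> in a minimal closed subsemigroup \<open>N\<close>, the right
  multiples of \<open>e\<close> form a closed subsemigroup, which is all of \<open>N\<close>. So
  some element fixes \<open>e\<close> from the left; such elements form a closed subsemigroup again,
  hence \<open>e\<close> is one of them. Continuity in the left argument is what makes both sets
  closed.\<close>

theorem ellis_idempotent:
  assumes "M \<noteq> {}" and "lim_closed lm M"
    and closed: "\<And>x y. x \<in> M \<Longrightarrow> y \<in> M \<Longrightarrow> op x y \<in> M"
    and assoc: "\<And>x y z. x \<in> M \<Longrightarrow> y \<in> M \<Longrightarrow> z \<in> M \<Longrightarrow> op (op x y) z = op x (op y z)"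
    and cont: "\<And>U y. is_ultrafilter U \<Longrightarrow> eventually (\<lambda>x. x \<in> M) U \<Longrightarrow> y \<in> M
                 \<Longrightarrow> op (lm U) y = lm (filtermap (\<lambda>x. op x y) U)"
    and lim_const: "\<And>x. lm (principal {x}) = x"
  shows "\<exists>e\<in>M. op e e = e"
proof -
  define A where "A = {N. N \<subseteq> M \<and> N \<noteq> {} \<and> lim_closed lm N \<and> (\<forall>x\<in>N. \<forall>y\<in>N. op x y \<in> N)}"
  have "\<exists>N\<in>A. \<forall>N'\<in>A. N' \<subseteq> N \<longrightarrow> N' = N"
  proof (rule chain_minimal_exists)
    show "A \<noteq> {}"
      using assms(1,2) closed by (auto simp: A_def)
    fix C assume C: "C \<subseteq> A" "C \<noteq> {}" "\<And>a b. a \<in> C \<Longrightarrow> b \<in> C \<Longrightarrow> a \<subseteq> b \<or> b \<subseteq> a"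
    have "lim_closed lm (\<Inter>C) \<and> \<Inter>C \<noteq> {}"
      using C by (intro lim_closed_chain_Inter) (auto simp: A_def)
    moreover have "op x y \<in> \<Inter>C" if "x \<in> \<Inter>C" "y \<in> \<Inter>C" for x y
      using that C(1) by (auto simp: A_def)
    moreover have "\<Inter>C \<subseteq> M"
      using C(1,2) by (fastforce simp: A_def)
    ultimately have "\<Inter>C \<in> A"
      by (simp add: A_def)
    then show "\<exists>u\<in>A. \<forall>a\<in>C. u \<subseteq> a"
      by (intro bexI[of _ "\<Inter>C"]) auto
  qed
  then obtain N where N: "N \<subseteq> M" "N \<noteq> {}" "lim_closed lm N"
      "\<And>x y. x \<in> N \<Longrightarrow> y \<in> N \<Longrightarrow> op x y \<in> N"
    and min: "\<And>N'. N' \<in> A \<Longrightarrow> N' \<subseteq> N \<Longrightarrow> N' = N"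
    by (auto simp: A_def)
  from N(2) obtain e where e: "e \<in> N"
    by auto
  have assocN: "op (op x y) z = op x (op y z)" if "x \<in> N" "y \<in> N" "z \<in> N" for x y z
    using that N(1) assoc by blast
  have contN: "op (lm U) e = lm (filtermap (\<lambda>x. op x e) U)"
    if "is_ultrafilter U" "eventually (\<lambda>x. x \<in> N) U" for U
  proof (rule cont[OF that(1)])
    show "eventually (\<lambda>x. x \<in> M) U"
      using that(2) by (rule eventually_mono) (use N(1) in auto)
    show "e \<in> M"
      using N(1) e by auto
  qed
  define R where "R = (\<lambda>x. op x e) ` N"
  have "lim_closed lm R"
    unfolding lim_closed_def
  proof (intro allI impI)
    fix U assume U: "is_ultrafilter U" "\<forall>\<^sub>F x in U. x \<in> R"
    \<comment> \<open>The image is closed: pull the ultrafilter back to \<open>N\<close> along a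
      section of right multiplication by \<open>e\<close>, take the limit there, and return by
      continuity.\<close>
    define pre where "pre = inv_into N (\<lambda>x. op x e)"
    have pre: "pre y \<in> N \<and> op (pre y) e = y" if "y \<in> R" for y
      using that f_inv_into_f[of y "\<lambda>x. op x e" N] inv_into_into[of y "\<lambda>x. op x e" N]
      by (simp add: pre_def R_def)
    define V where "V = filtermap pre U"
    have V: "is_ultrafilter V" "\<forall>\<^sub>F x in V. x \<in> N"
      using U(1) eventually_mono[OF U(2)] pre
      by (auto simp: V_def ultrafilter_filtermap eventually_filtermap)
    have "filtermap (\<lambda>x. op x e) V = filtermap (\<lambda>y. y) U"
      unfolding V_def filtermap_filtermap 
      by (intro filtermap_cong_eventually eventually_mono[OF U(2)]) (simp add: pre)
    then have "lm U = op (lm V) e"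
      using contN[OF V] by simp
    moreover have "lm V \<in> N"
      using N(3) V by (rule lim_closedD)
    ultimately show "lm U \<in> R"
      by (simp add: R_def)
  qed
  moreover have "op x y \<in> R" if x: "x \<in> R" and y: "y \<in> R" for x y
  proof -
    from x y obtain x' y' where "x' \<in> N" "y' \<in> N" "x = op x' e" "y = op y' e"
      by (auto simp: R_def)
    then have "op x y = op (op (op x' e) y') e"
      using assocN N(4) e by auto
    then show ?thesis
      using \<open>x' \<in> N\<close> \<open>y' \<in> N\<close> N(4) e by (auto simp: R_def)
  qed
  moreover have "R \<subseteq> N"
    using N(4) e by (auto simp: R_def)
  ultimately have "R = N"
    using N e by (intro min) (auto simp: A_def R_def)
  then have stab: "\<exists>x. x \<in> N \<and> op x e = e"
    using e unfolding R_def by (metis imageE)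
  \<comment> \<open>The left stabilizer of \<open>e\<close>, nonempty because \<open>e\<close> lies
    in \<open>R = N\<close>.\<close>
  define L where "L = {x \<in> N. op x e = e}"
  have "lim_closed lm L"
    unfolding lim_closed_def
  proof (intro allI impI)
    fix U assume U: "is_ultrafilter U" "\<forall>\<^sub>F x in U. x \<in> L"
    from U(2) have UN: "\<forall>\<^sub>F x in U. x \<in> N"
      by (rule eventually_mono) (simp add: L_def)
    have "U \<noteq> bot"
      using U(1) by (simp add: is_ultrafilter_def)
    have "filtermap (\<lambda>x. op x e) U = filtermap (\<lambda>_. e) U"
      by (intro filtermap_cong_eventually eventually_mono[OF U(2)]) (simp add: L_def)
    also have "\<dots> = principal {e}"
      using \<open>U \<noteq> bot\<close> by (auto simp: filter_eq_iff eventually_filtermap eventually_principal)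
    finally have "op (lm U) e = e"
      using contN[OF U(1) UN] lim_const by simp
    then show "lm U \<in> L"
      using lim_closedD[OF N(3) U(1) UN] by (simp add: L_def)
  qed
  then have "L = N"
    using N e stab assocN by (intro min) (auto simp: A_def L_def)
  with e have "op e e = e"
    by (auto simp: L_def)
  then show ?thesis
    using e N(1) by blast
qed

section \<open>Addition and limits of ultrafilters\<close>

text \<open>
  The junk value of \<open>the None\<close> is harmless on \<open>gammaS\<close>, where \<open>add x y\<close> is defined for
  almost all \<open>y\<close>.
\<close>

definition gplus :: "'s pop \<Rightarrow> 's filter \<Rightarrow> 's filter \<Rightarrow> 's filter" where
  "gplus add U V = Abs_filter (\<lambda>P. \<forall>\<^sub>F x in U. \<forall>\<^sub>F y in V. P (the (add x y)))"

lemma eventually_gplus: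
  "eventually P (gplus add U V) \<longleftrightarrow> (\<forall>\<^sub>F x in U. \<forall>\<^sub>F y in V. P (the (add x y)))"
  unfolding gplus_def
proof (rule eventually_Abs_filter, rule is_filter.intro)
  fix P Q
  assume P: "\<forall>\<^sub>F x in U. \<forall>\<^sub>F y in V. P (the (add x y))"
  show "\<forall>\<^sub>F x in U. \<forall>\<^sub>F y in V. P (the (add x y)) \<and> Q (the (add x y))"
    if "\<forall>\<^sub>F x in U. \<forall>\<^sub>F y in V. Q (the (add x y))"
    using P that by eventually_elim (rule eventually_conj)
  show "\<forall>\<^sub>F x in U. \<forall>\<^sub>F y in V. Q (the (add x y))" if "\<forall>s. P s \<longrightarrow> Q s"
    using P by eventually_elim (use that in \<open>auto elim: eventually_mono\<close>)
qed auto

text \<open>The limit of an ultrafilter in the product over \<open>T\<close> of the spaces of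
  ultrafilters, taken coordinatewise.\<close>

definition flim :: "('t \<Rightarrow> 's filter) filter \<Rightarrow> 't \<Rightarrow> 's filter" where
  "flim U t = Abs_filter (\<lambda>P. \<forall>\<^sub>F \<xi> in U. eventually P (\<xi> t))"

lemma eventually_flim: "eventually P (flim U t) \<longleftrightarrow> (\<forall>\<^sub>F \<xi> in U. eventually P (\<xi> t))"
  unfolding flim_def
proof (rule eventually_Abs_filter, rule is_filter.intro)
  fix P Q
  assume P: "\<forall>\<^sub>F \<xi> in U. eventually P (\<xi> t)"
  show "\<forall>\<^sub>F \<xi> in U. \<forall>\<^sub>F s in \<xi> t. P s \<and> Q s" if "\<forall>\<^sub>F \<xi> in U. eventually Q (\<xi> t)"
    using P that by eventually_elim (rule eventually_conj)
  show "\<forall>\<^sub>F \<xi> in U. eventually Q (\<xi> t)" if "\<forall>s. P s \<longrightarrow> Q s"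
    using P by eventually_elim (use that in \<open>auto elim: eventually_mono\<close>)
qed auto

lemma flim_principal: "flim (principal {\<xi>}) = \<xi>"
  by (rule ext) (auto simp: filter_eq_iff eventually_flim eventually_principal)

lemma ultrafilter_flim:
  assumes U: "is_ultrafilter U" and "\<forall>\<^sub>F \<xi> in U. is_ultrafilter (\<xi> t)"
  shows "is_ultrafilter (flim U t)"
proof -
  have "\<not> eventually (\<lambda>_. False) (flim U t)"
    unfolding eventually_flim ultrafilter_not[OF U, symmetric]
    using assms(2) by eventually_elim (simp add: is_ultrafilter_def eventually_False)
  moreover have "eventually P (flim U t) \<or> eventually (\<lambda>s. \<not> P s) (flim U t)" for P
  proof (cases "\<forall>\<^sub>F \<xi> in U. eventually P (\<xi> t)")
    case False
    then have "\<forall>\<^sub>F \<xi> in U. \<not> eventually P (\<xi> t)"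
      by (simp add: ultrafilter_not[OF U])
    with assms(2) have "\<forall>\<^sub>F \<xi> in U. \<forall>\<^sub>F s in \<xi> t. \<not> P s"
      by eventually_elim (simp add: ultrafilter_not)
    then show ?thesis
      by (simp add: eventually_flim)
  qed (simp add: eventually_flim)
  ultimately show ?thesis
    by (auto simp: is_ultrafilter_def eventually_False)
qed

section \<open>Trees\<close>

lemma tree_le_refl [simp]: "tree_le par t t"
  by (auto simp: tree_le_def intro: exI[of _ 0])

lemma tree_le_par [simp]: "tree_le par t (par t)"
  by (auto simp: tree_le_def intro: exI[of _ 1])

lemma tree_le_trans: "tree_le par s t \<Longrightarrow> tree_le par t u \<Longrightarrow> tree_le par s u"
  unfolding tree_le_def by (metis comp_apply funpow_add)

lemma tree_le_induct [consumes 1, case_names refl step]: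
  assumes "tree_le par s t" and "P t" and "\<And>s. tree_le par (par s) t \<Longrightarrow> P (par s) \<Longrightarrow> P s"
  shows "P s"
proof -
  obtain n where "(par ^^ n) s = t"
    using assms(1) by (auto simp: tree_le_def)
  then show ?thesis
  proof (induction n arbitrary: s)
    case (Suc n)
    then have "(par ^^ n) (par s) = t"
      by (simp add: funpow_swap1)
    then show ?case
      using assms(3)[of s] Suc.IH[of "par s"] by (auto simp: tree_le_def)
  qed (use assms(2) in simp)
qed

text \<open>Both nodes are iterated parents of \<open>s\<close>; the one reached in fewer steps is
  below the other.\<close>

lemma ancestors_comparable:
  assumes "tree_le par s t" and "tree_le par s u"
  shows "tree_le par t u \<or> tree_le par u t"
proof -
  obtain i j where ij: "(par ^^ i) s = t" "(par ^^ j) s = u"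
    using assms by (auto simp: tree_le_def)
  show ?thesis
  proof (cases "i \<le> j")
    case True
    then have "(par ^^ (j - i)) t = u"
      using ij by (metis comp_apply funpow_add le_add_diff_inverse2)
    then show ?thesis by (auto simp: tree_le_def)
  next
    case False
    then have "(par ^^ (i - j)) u = t"
      using ij by (metis comp_apply funpow_add le_add_diff_inverse2 nle_le)
    then show ?thesis by (auto simp: tree_le_def)
  qed
qed

lemma root_iterate: "rooted_tree r par \<Longrightarrow> (par ^^ n) r = r"
  by (induction n) (auto simp: rooted_tree_def)

text \<open>A cycle through \<open>s\<close> can be repeated until it exceeds the height of
  \<open>s\<close>; then it ends at the root, so \<open>s\<close> is the root.\<close>

lemma tree_le_antisym:
  assumes tree: "rooted_tree r par" and "tree_le par s t" and "tree_le par t s"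
  shows "s = t"
proof -
  obtain m n where mn: "(par ^^ m) s = t" "(par ^^ n) t = s"
    using assms by (auto simp: tree_le_def)
  obtain N where N: "(par ^^ N) s = r"
    using tree by (auto simp: rooted_tree_def)
  show ?thesis
  proof (cases "m = 0")
    case False
    have "(par ^^ (n + m)) s = s"
      using mn by (simp add: funpow_add)
    then have "((par ^^ (n + m)) ^^ N) s = s"
      by (induction N) auto
    then have "(par ^^ ((n + m) * N)) s = s"
      by (simp add: funpow_mult)
    \<comment> \<open>As \<open>m\<close> is positive, the product is at least \<open>N\<close>, and
      the truncated subtraction is exact.\<close>
    moreover have "(n + m) * N = ((n + m) * N - N) + N"
      using False by simp
    ultimately have "s = (par ^^ ((n + m) * N - N)) ((par ^^ N) s)"
      by (metis comp_apply funpow_add)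
    then have "s = r"
      using N root_iterate[OF tree] by simp
    then show ?thesis
      using mn root_iterate[OF tree] by auto
  qed (use mn in simp)
qed

lemma finite_height:
  assumes "rooted_tree (r :: 't::finite) par"
  obtains N where "\<And>t. (par ^^ N) t = r"
proof -
  obtain h where h: "\<And>t. (par ^^ h t) t = r"
    using assms unfolding rooted_tree_def by metis
  \<comment> \<open>The sum of all heights is a common height, because surplus steps stay at the
    root.\<close>
  have "(par ^^ (\<Sum>u\<in>UNIV. h u)) t = r" for t
  proof -
    have "(\<Sum>u\<in>UNIV. h u) = (\<Sum>u\<in>UNIV - {t}. h u) + h t"
      by (subst sum.remove[of UNIV t]) (auto simp: add.commute)
    then show ?thesis
      by (simp add: funpow_add h root_iterate[OF assms])
  qed
  with that show thesis .
qed

lemma regressive_hom_par: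
  assumes "regressive_hom par h"
  shows "h (par t) = h t \<or> h (par t) = par (h t)"
  using assms unfolding regressive_hom_def child_of_def by metis

text \<open>The minimum of two comparable nodes; for incomparable nodes the value \<open>t\<close>
  is a default.\<close>

definition tmin :: "('t \<Rightarrow> 't) \<Rightarrow> 't \<Rightarrow> 't \<Rightarrow> 't" where
  "tmin par s t = (if tree_le par s t then s else t)"

definition comparable :: "('t \<Rightarrow> 't) \<Rightarrow> 't \<Rightarrow> 't \<Rightarrow> bool" where
  "comparable par s t \<longleftrightarrow> tree_le par s t \<or> tree_le par t s"

section \<open>Path sums and regressive homomorphisms\<close>

text \<open>
  Sums of labels along the path from a node to the root.  A regressive homomorphism maps this path
  onto a path with repetitions, which idempotent labels absorb.
\<close>

primrec pathsum :: "('a \<Rightarrow> 'a \<Rightarrow> 'a) \<Rightarrow> ('t \<Rightarrow> 't) \<Rightarrow> ('t \<Rightarrow> 'a) \<Rightarrow> nat \<Rightarrow> 't \<Rightarrow> 'a" where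
  "pathsum op par \<xi> 0 t = \<xi> t"
| "pathsum op par \<xi> (Suc n) t = op (\<xi> t) (pathsum op par \<xi> n (par t))"

lemma pathsum_closed:
  assumes "\<And>x y. x \<in> G \<Longrightarrow> y \<in> G \<Longrightarrow> op x y \<in> G" and "\<And>t. \<xi> t \<in> G"
  shows "pathsum op par \<xi> n t \<in> G"
  by (induction n arbitrary: t) (use assms in auto)

text \<open>The sum collapses from its far end. Thus path sums leave the labels unchanged on levels
  that are already ordered.\<close>

lemma pathsum_absorb:
  assumes "\<And>t. t \<in> W \<Longrightarrow> par t \<in> W" and "\<And>t. t \<in> W \<Longrightarrow> op (\<xi> t) (\<xi> (par t)) = \<xi> t" and "t \<in> W"
  shows "pathsum op par \<xi> n t = \<xi> t"
  using assms(3) by (induction n arbitrary: t) (use assms in auto)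

text \<open>A step beyond the root repeats the last label, which is idempotent.\<close>

lemma pathsum_stable:
  assumes "rooted_tree r par" and "op (\<xi> r) (\<xi> r) = \<xi> r" and "(par ^^ n) t = r"
  shows "pathsum op par \<xi> (Suc n) t = pathsum op par \<xi> n t"
  using assms(3)
proof (induction n arbitrary: t)
  case 0
  then show ?case
    using assms(1,2) by (auto simp: rooted_tree_def)
next
  case (Suc n)
  then have "(par ^^ n) (par t) = r"
    by (simp add: funpow_swap1)
  from Suc.IH[OF this] show ?case
    by simp
qed

text \<open>From \<open>t\<close> to \<open>par t\<close> the image under \<phi> either moves to its
  parent, where both sums proceed alike, or stays. If it stays, the label at \<phi> t occurs twice
  on the left and is absorbed by idempotence, while the extra step on the right happens at the
  root.\<close>

lemma pathsum_hom:
  assumes tree: "rooted_tree r par" and reg: "regressive_hom par \<phi>"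
    and closed: "\<And>x y. x \<in> G \<Longrightarrow> y \<in> G \<Longrightarrow> op x y \<in> G"
    and assoc: "\<And>x y z. x \<in> G \<Longrightarrow> y \<in> G \<Longrightarrow> z \<in> G \<Longrightarrow> op (op x y) z = op x (op y z)"
    and hom: "\<And>x y. x \<in> G \<Longrightarrow> y \<in> G \<Longrightarrow> h (op x y) = op (h x) (h y)"
    and G: "\<And>t. \<xi> t \<in> G" and idem: "\<And>t. op (\<xi> t) (\<xi> t) = \<xi> t"
    and equi: "\<And>t. h (\<xi> t) = \<xi> (\<phi> t)"
    and "(par ^^ n) t = r"
  shows "h (pathsum op par \<xi> n t) = pathsum op par \<xi> n (\<phi> t)"
  using assms(9)
proof (induction n arbitrary: t)
  case 0
  then show ?case
    by (simp add: equi)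
next
  case (Suc n)
  let ?p = "pathsum op par \<xi>"
  have n: "(par ^^ n) (par t) = r"
    using Suc.prems by (simp add: funpow_swap1)
  have pG: "?p m u \<in> G" for m u
    using closed G by (rule pathsum_closed)
  have "h (?p (Suc n) t) = op (\<xi> (\<phi> t)) (?p n (\<phi> (par t)))"
    using hom[OF G pG] Suc.IH[OF n] equi by simp
  also have "\<dots> = ?p (Suc n) (\<phi> t)"
    using regressive_hom_par[OF reg, of t]
  proof
    assume eq: "\<phi> (par t) = \<phi> t"
    \<comment> \<open>Regressiveness at \<open>par t\<close> puts \<phi> t above
      \<open>par t\<close>, so \<open>n\<close> steps lead from \<phi> t to the root as
      well.\<close>
    obtain j where j: "(par ^^ j) (par t) = \<phi> t"
      using reg eq unfolding regressive_hom_def tree_le_def by metis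
    have "(par ^^ n) (\<phi> t) = (par ^^ (j + n)) (par t)"
      using j by (simp add: add.commute[of j] funpow_add)
    also have "\<dots> = r"
      using n root_iterate[OF tree] by (simp add: funpow_add)
    finally have "?p (Suc n) (\<phi> t) = ?p n (\<phi> t)"
      using pathsum_stable[where op = op and \<xi> = \<xi>] tree idem by metis
    moreover have "op (\<xi> u) (?p n u) = ?p n u" for u
    proof (cases n)
      case (Suc m)
      show ?thesis
        unfolding Suc pathsum.simps assoc[OF G G pG, symmetric] idem ..
    qed (simp add: idem)
    ultimately show ?thesis
      using eq by simp
  qed simp
  finally show ?case .
qed

section \<open>The semigroup of ultrafilters\<close>

lemma gammaS_ultra: "U \<in> gammaS add \<Longrightarrow> is_ultrafilter U"
  by (simp add: gammaS_def)

lemma gammaS_defined: "U \<in> gammaS add \<Longrightarrow> \<forall>\<^sub>F y in U. add x y \<noteq> None"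
  by (simp add: gammaS_def)

lemma gamma_subD: "U \<in> gamma_sub add C \<Longrightarrow> U \<in> gammaS add \<and> (\<forall>\<^sub>F s in U. s \<in> C)"
  by (simp add: gamma_sub_def)

lemma partial_assoc:
  assumes "partial_semigroup UNIV add" and "add x y = Some u" and "add u w = Some z"
  obtains v where "add y w = Some v" and "add x v = Some z"
  using assms unfolding partial_semigroup_def by (metis UNIV_I bind.bind_lunit bind_eq_Some_conv)

text \<open>Almost every \<open>y\<close>, and then almost every \<open>w\<close>, makes the sums
  defined; there partial associativity identifies the two sides inside the iterated
  quantifiers.\<close>

lemma gplus_assoc:
  assumes ps: "partial_semigroup UNIV add" and V: "V \<in> gammaS add" and W: "W \<in> gammaS add"
  shows "gplus add (gplus add U V) W = gplus add U (gplus add V W)"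
proof -
  have "(\<forall>\<^sub>F y in V. \<forall>\<^sub>F w in W. P (the (add (the (add x y)) w))) \<longleftrightarrow>
        (\<forall>\<^sub>F y in V. \<forall>\<^sub>F w in W. P (the (add x (the (add y w)))))" for P x
  proof (rule eventually_cong[OF gammaS_defined[OF V, of x]])
    fix y assume "add x y \<noteq> None"
    then obtain u where u: "add x y = Some u"
      by auto
    show "(\<forall>\<^sub>F w in W. P (the (add (the (add x y)) w))) \<longleftrightarrow>
          (\<forall>\<^sub>F w in W. P (the (add x (the (add y w)))))"
    proof (rule eventually_cong[OF gammaS_defined[OF W, of u]])
      fix w assume "add u w \<noteq> None"
      then obtain z where "add u w = Some z"
        by auto
      moreover obtain v where "add y w = Some v" "add x v = Some z"
        using partial_assoc[OF ps u calculation] .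
      ultimately show "P (the (add (the (add x y)) w)) \<longleftrightarrow> P (the (add x (the (add y w))))"
        using u by simp
    qed
  qed
  then show ?thesis
    by (simp add: filter_eq_iff eventually_gplus)
qed

lemma ultrafilter_gplus:
  assumes U: "is_ultrafilter U" and V: "is_ultrafilter V"
  shows "is_ultrafilter (gplus add U V)"
proof -
  have "eventually (\<lambda>s. \<not> P s) (gplus add U V) \<longleftrightarrow> \<not> eventually P (gplus add U V)" for P
    by (simp add: eventually_gplus ultrafilter_not[OF V] ultrafilter_not[OF U])
  moreover have "gplus add U V \<noteq> bot"
    unfolding trivial_limit_def eventually_gplus using U V by (simp add: is_ultrafilter_def)
  ultimately show ?thesis
    by (auto simp: is_ultrafilter_def)
qed

text \<open>For almost all \<open>y\<close> and then almost all \<open>z\<close>, both x + y and (x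
  + y) + z are defined, and by associativity so is x + (y + z).\<close>

lemma gplus_gammaS:
  assumes ps: "partial_semigroup UNIV add" and U: "U \<in> gammaS add" and V: "V \<in> gammaS add"
  shows "gplus add U V \<in> gammaS add"
proof -
  have "\<forall>\<^sub>F y in U. \<forall>\<^sub>F z in V. add x (the (add y z)) \<noteq> None" for x
    using gammaS_defined[OF U, of x]
  proof eventually_elim
    fix y assume "add x y \<noteq> None"
    then obtain u where u: "add x y = Some u"
      by auto
    show "\<forall>\<^sub>F z in V. add x (the (add y z)) \<noteq> None"
      using gammaS_defined[OF V, of u]
    proof eventually_elim
      fix z assume "add u z \<noteq> None"
      then obtain w where "add u z = Some w"
        by auto
      with partial_assoc[OF ps u] show "add x (the (add y z)) \<noteq> None"
        by (metis option.sel option.distinct(1))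
    qed
  qed
  then show ?thesis
    using ultrafilter_gplus[of U V add] U V by (simp add: gammaS_def eventually_gplus)
qed

text \<open>The order of the subsemigroups passes to ultrafilters, in both orders of addition; this
  keeps path sums in the right subsemigroup.\<close>

lemma gplus_gamma_sub:
  assumes ps: "partial_semigroup UNIV add" and le: "subsemigroup_le add A B"
    and U: "U \<in> gamma_sub add A" and V: "V \<in> gamma_sub add B"
  shows "gplus add U V \<in> gamma_sub add A \<and> gplus add V U \<in> gamma_sub add A"
proof -
  note U' = gamma_subD[OF U] and V' = gamma_subD[OF V]
  have le': "a \<in> A \<Longrightarrow> b \<in> B \<Longrightarrow> add a b = Some z \<or> add b a = Some z \<Longrightarrow> z \<in> A" for a b z
    using le unfolding subsemigroup_le_def by blast
  have "\<forall>\<^sub>F x in U. \<forall>\<^sub>F y in V. the (add x y) \<in> A"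
    using conjunct2[OF U']
  proof eventually_elim
    fix x assume "x \<in> A"
    show "\<forall>\<^sub>F y in V. the (add x y) \<in> A"
      using conjunct2[OF V'] gammaS_defined[OF conjunct1[OF V'], of x]
      by eventually_elim (use le'[OF \<open>x \<in> A\<close>] in force)
  qed
  moreover have "\<forall>\<^sub>F x in V. \<forall>\<^sub>F y in U. the (add x y) \<in> A"
    using conjunct2[OF V']
  proof eventually_elim
    fix x assume "x \<in> B"
    show "\<forall>\<^sub>F y in U. the (add x y) \<in> A"
      using conjunct2[OF U'] gammaS_defined[OF conjunct1[OF U'], of x]
      by eventually_elim (use le'[OF _ \<open>x \<in> B\<close>] in force)
  qed
  ultimately show ?thesis
    using U' V' gplus_gammaS[OF ps] by (simp add: gamma_sub_def eventually_gplus)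
qed

lemma End_add: "\<tau> \<in> End add \<Longrightarrow> add (\<tau> x) (\<tau> y) = map_option \<tau> (add x y)"
  by (simp add: End_def adequate_hom_def partial_hom_def)

lemma filtermap_gplus:
  assumes \<tau>: "\<tau> \<in> End add" and V: "V \<in> gammaS add"
  shows "filtermap \<tau> (gplus add U V) = gplus add (filtermap \<tau> U) (filtermap \<tau> V)"
proof -
  have "(\<forall>\<^sub>F y in V. P (\<tau> (the (add x y)))) \<longleftrightarrow> (\<forall>\<^sub>F y in V. P (the (add (\<tau> x) (\<tau> y))))" for P x
    by (rule eventually_cong[OF gammaS_defined[OF V, of x]]) (auto simp: End_add[OF \<tau>])
  then show ?thesis
    by (simp add: filter_eq_iff eventually_gplus eventually_filtermap)
qed

text \<open>Adequacy of \<tau> enters here: finitely many definedness conditions on \<open>y\<close>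
  guarantee that x + \<tau> y is defined.\<close>

lemma filtermap_gammaS:
  assumes \<tau>: "\<tau> \<in> End add" and U: "U \<in> gammaS add"
  shows "filtermap \<tau> U \<in> gammaS add"
proof -
  have "\<forall>\<^sub>F y in U. add x (\<tau> y) \<noteq> None" for x
  proof -
    obtain A where A: "finite A" "\<tau> ` phi UNIV add A \<subseteq> phi UNIV add {x}"
      using \<tau> by (auto simp: End_def adequate_hom_def dest!: spec[of _ "{x}"])
    have "\<forall>\<^sub>F y in U. \<forall>a\<in>A. add a y \<noteq> None"
      using A(1) gammaS_defined[OF U] by (intro eventually_ball_finite) auto
    then show ?thesis
    proof eventually_elim
      fix y assume "\<forall>a\<in>A. add a y \<noteq> None"
      then have "\<tau> y \<in> phi UNIV add {x}"
        using A(2) by (auto simp: phi_def)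
      then show "add x (\<tau> y) \<noteq> None"
        by (simp add: phi_def)
    qed
  qed
  then show ?thesis
    using U by (simp add: gammaS_def ultrafilter_filtermap eventually_filtermap)
qed

section \<open>Ordered idempotents\<close>

definition gadd :: "'s pop \<Rightarrow> ('t \<Rightarrow> 's filter) \<Rightarrow> ('t \<Rightarrow> 's filter) \<Rightarrow> 't \<Rightarrow> 's filter" where
  "gadd add \<xi> \<eta> t = gplus add (\<xi> t) (\<eta> t)"

text \<open>Continuity in the left argument: the left summand is the outer quantifier in
  \<open>eventually_gplus\<close>, so it commutes with the limit.\<close>

lemma gadd_flim: "gadd add (flim U) \<eta> = flim (filtermap (\<lambda>\<xi>. gadd add \<xi> \<eta>) U)"
  by (rule ext)
    (simp add: filter_eq_iff gadd_def eventually_gplus eventually_flim eventually_filtermap)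

lemma flim_const:
  assumes "is_ultrafilter U" and "\<forall>\<^sub>F \<eta> in U. \<eta> t = V"
  shows "flim U t = V"
proof -
  have "(\<forall>\<^sub>F \<eta> in U. eventually P (\<eta> t)) \<longleftrightarrow> (\<forall>\<^sub>F \<eta> in U. eventually P V)" for P
    using assms(2) by (rule eventually_cong) simp
  then show ?thesis
    using assms(1) by (simp add: filter_eq_iff eventually_flim is_ultrafilter_def)
qed

lemma gplus_flim_absorb:
  assumes "\<forall>\<^sub>F \<eta> in U. gplus add (\<eta> t) V = \<eta> t"
  shows "gplus add (flim U t) V = flim U t"
proof -
  have "(\<forall>\<^sub>F \<eta> in U. eventually P (gplus add (\<eta> t) V)) \<longleftrightarrow> (\<forall>\<^sub>F \<eta> in U. eventually P (\<eta> t))" for P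
    using assms by (rule eventually_cong) simp
  then show ?thesis
    by (simp add: filter_eq_iff eventually_flim eventually_gplus)
qed

section \<open>The compact semigroup of equivariant families of ultrafilters\<close>

locale regressive_tree_action =
  fixes r :: "'t::finite" and par :: "'t \<Rightarrow> 't"
    and add :: "'s \<Rightarrow> 's \<Rightarrow> 's option"
    and St :: "'t \<Rightarrow> 's set"
    and F :: "('s \<Rightarrow> 's) set"
    and f :: "('s \<Rightarrow> 's) \<Rightarrow> 't \<Rightarrow> 't"
  assumes tree: "rooted_tree r par"
    and adequate_add: "adequate UNIV add"
    and action: "tree_action par add St F f"
    and regressive: "\<And>\<tau>. \<tau> \<in> F \<Longrightarrow> regressive_hom par (f \<tau>)"
begin

abbreviation K :: "('t \<Rightarrow> 's filter) set" where
  "K \<equiv> gamma_action add St F f"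

lemma semigroup: "partial_semigroup UNIV add"
  using adequate_add by (simp add: adequate_def)

lemma subsemigroup_mono: "tree_le par s t \<Longrightarrow> subsemigroup_le add (St s) (St t)"
  using action by (simp add: tree_action_def)

lemma F_End: "\<tau> \<in> F \<Longrightarrow> \<tau> \<in> End add"
  using action by (auto simp: tree_action_def)

lemma spine_maps: "\<tau> \<in> F \<Longrightarrow> s \<in> St t \<Longrightarrow> \<tau> s \<in> St (f \<tau> t)"
  using action unfolding tree_action_def by blast

lemma K_gamma_sub: "\<xi> \<in> K \<Longrightarrow> \<xi> t \<in> gamma_sub add (St t)"
  by (simp add: gamma_action_def)

lemma K_gammaS: "\<xi> \<in> K \<Longrightarrow> \<xi> t \<in> gammaS add"
  using K_gamma_sub gamma_subD by blast

lemma K_ultra: "\<xi> \<in> K \<Longrightarrow> is_ultrafilter (\<xi> t)"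
  using K_gammaS gammaS_ultra by blast

lemma K_equivariant: "\<xi> \<in> K \<Longrightarrow> \<tau> \<in> F \<Longrightarrow> filtermap \<tau> (\<xi> t) = \<xi> (f \<tau> t)"
  by (auto simp: gamma_action_def fun_eq_iff)

lemma K_I:
  assumes "\<And>t. \<xi> t \<in> gamma_sub add (St t)"
    and "\<And>\<tau> t. \<tau> \<in> F \<Longrightarrow> filtermap \<tau> (\<xi> t) = \<xi> (f \<tau> t)"
  shows "\<xi> \<in> K"
  using assms by (auto simp: gamma_action_def fun_eq_iff)

lemma K_gadd:
  assumes "\<xi> \<in> K" and "\<eta> \<in> K"
  shows "gadd add \<xi> \<eta> \<in> K"
proof (rule K_I)
  fix t
  show "gadd add \<xi> \<eta> t \<in> gamma_sub add (St t)"
    using gplus_gamma_sub[OF semigroup subsemigroup_mono[OF tree_le_refl]] assms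
    by (simp add: gadd_def K_gamma_sub)
  show "filtermap \<tau> (gadd add \<xi> \<eta> t) = gadd add \<xi> \<eta> (f \<tau> t)" if "\<tau> \<in> F" for \<tau>
    using filtermap_gplus[OF F_End[OF that] K_gammaS[OF assms(2)]] assms that
    by (simp add: gadd_def K_equivariant)
qed

lemma gadd_assoc:
  assumes "\<eta> \<in> K" and "\<zeta> \<in> K"
  shows "gadd add (gadd add \<xi> \<eta>) \<zeta> = gadd add \<xi> (gadd add \<eta> \<zeta>)"
  using assms by (auto simp: fun_eq_iff gadd_def gplus_assoc semigroup K_gammaS)

text \<open>Membership, definedness and equivariance are tested on one set at a time, and tests that
  hold at almost all \<xi> pass to \<open>flim\<close>.\<close>

lemma K_lim_closed: "lim_closed flim K"
  unfolding lim_closed_def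
proof (intro allI impI K_I)
  fix U assume U: "is_ultrafilter U" and K: "\<forall>\<^sub>F \<xi> in U. \<xi> \<in> K"
  fix t
  have "\<forall>\<^sub>F \<xi> in U. is_ultrafilter (\<xi> t)"
    using K by eventually_elim (rule K_ultra)
  moreover have "\<forall>\<^sub>F \<xi> in U. \<forall>\<^sub>F s in \<xi> t. s \<in> St t"
    using K by eventually_elim (use K_gamma_sub gamma_subD in blast)
  moreover have "\<forall>\<^sub>F \<xi> in U. \<forall>\<^sub>F y in \<xi> t. add x y \<noteq> None" for x
    using K by eventually_elim (rule gammaS_defined, rule K_gammaS)
  ultimately show "flim U t \<in> gamma_sub add (St t)"
    using ultrafilter_flim[OF U] by (simp add: gamma_sub_def gammaS_def eventually_flim)
  fix \<tau> assume "\<tau> \<in> F"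
  have "(\<forall>\<^sub>F \<xi> in U. eventually P (filtermap \<tau> (\<xi> t))) \<longleftrightarrow> (\<forall>\<^sub>F \<xi> in U. eventually P (\<xi> (f \<tau> t)))" for P
    using K by (rule eventually_cong) (simp add: K_equivariant \<open>\<tau> \<in> F\<close>)
  then show "filtermap \<tau> (flim U t) = flim U (f \<tau> t)"
    by (simp add: filter_eq_iff eventually_filtermap eventually_flim)
qed

lemma K_idempotent:
  assumes "M \<subseteq> K" and "M \<noteq> {}" and "lim_closed flim M"
    and "\<And>\<xi> \<eta>. \<xi> \<in> M \<Longrightarrow> \<eta> \<in> M \<Longrightarrow> gadd add \<xi> \<eta> \<in> M"
  shows "\<exists>\<zeta>\<in>M. \<forall>t. gplus add (\<zeta> t) (\<zeta> t) = \<zeta> t"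
proof -
  have "\<exists>\<zeta>\<in>M. gadd add \<zeta> \<zeta> = \<zeta>"
  proof (rule ellis_idempotent[where op = "gadd add" and lm = flim])
    show "gadd add (gadd add \<xi> \<eta>) \<zeta> = gadd add \<xi> (gadd add \<eta> \<zeta>)"
      if "\<xi> \<in> M" "\<eta> \<in> M" "\<zeta> \<in> M" for \<xi> \<eta> \<zeta>
      using that assms(1) by (intro gadd_assoc) auto
  qed (use assms in \<open>simp_all add: gadd_flim flim_principal\<close>)
  then obtain \<zeta> where "\<zeta> \<in> M" and \<zeta>: "gadd add \<zeta> \<zeta> = \<zeta>"
    by blast
  have "\<forall>t. gplus add (\<zeta> t) (\<zeta> t) = \<zeta> t"
    using fun_cong[OF \<zeta>] by (simp add: gadd_def)
  with \<open>\<zeta> \<in> M\<close> show ?thesis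
    by blast
qed

text \<open>Adding labels of ancestors on either side stays in the subsemigroup at \<open>t\<close>;
  equivariance is \<open>pathsum_hom\<close>. The reversed operation is included because sums in
  both orders are used.\<close>

lemma K_pathsum:
  assumes \<xi>: "\<xi> \<in> K" and idem: "\<And>t. gplus add (\<xi> t) (\<xi> t) = \<xi> t"
    and op: "op = gplus add \<or> op = (\<lambda>U V. gplus add V U)"
    and n: "\<And>t. (par ^^ n) t = r"
  shows "pathsum op par \<xi> n \<in> K"
proof (rule K_I)
  fix t
  show "pathsum op par \<xi> n t \<in> gamma_sub add (St t)"
  proof (induction n arbitrary: t)
    case (Suc n)
    show ?case
      using gplus_gamma_sub[OF semigroup subsemigroup_mono[OF tree_le_par] K_gamma_sub[OF \<xi>] Suc.IH]
        op by auto
  qed (use \<xi> in \<open>simp add: K_gamma_sub\<close>)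
  fix \<tau> assume \<tau>: "\<tau> \<in> F"
  show "filtermap \<tau> (pathsum op par \<xi> n t) = pathsum op par \<xi> n (f \<tau> t)"
  proof (rule pathsum_hom[where G = "gammaS add" and op = op and h = "filtermap \<tau>", OF tree regressive[OF \<tau>]])
    show "op U V \<in> gammaS add" if "U \<in> gammaS add" "V \<in> gammaS add" for U V
      using op that gplus_gammaS[OF semigroup] by auto
    show "op (op U V) W = op U (op V W)"
      if "U \<in> gammaS add" "V \<in> gammaS add" "W \<in> gammaS add" for U V W
      using op that gplus_assoc[OF semigroup] by auto
    show "filtermap \<tau> (op U V) = op (filtermap \<tau> U) (filtermap \<tau> V)"
      if "U \<in> gammaS add" "V \<in> gammaS add" for U V
      using op that filtermap_gplus[OF F_End[OF \<tau>]] by auto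
  qed (use op \<xi> \<tau> idem n in \<open>auto simp: K_gammaS K_equivariant\<close>)
qed

text \<open>Absorption is demanded between a node and its parent; it spreads to all ancestors along
  paths.\<close>

definition ordered_on :: "'t set \<Rightarrow> ('t \<Rightarrow> 's filter) \<Rightarrow> bool" where
  "ordered_on W \<xi> \<longleftrightarrow> (\<forall>t\<in>W. gplus add (\<xi> t) (\<xi> t) = \<xi> t \<and>
     gplus add (\<xi> t) (\<xi> (par t)) = \<xi> t \<and> gplus add (\<xi> (par t)) (\<xi> t) = \<xi> t)"

lemma ordered_onD:
  assumes "ordered_on W \<xi>" and "t \<in> W"
  shows "gplus add (\<xi> t) (\<xi> t) = \<xi> t" and "gplus add (\<xi> t) (\<xi> (par t)) = \<xi> t"
    and "gplus add (\<xi> (par t)) (\<xi> t) = \<xi> t"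
  using assms by (simp_all add: ordered_on_def)

text \<open>Ellis' lemma for the points of \<open>K\<close> that agree with \<xi> on
  \<open>W\<close>; they are closed under addition because the prescribed values are
  idempotent.\<close>

lemma idempotent_extension:
  assumes \<xi>: "\<xi> \<in> K" and idem: "\<And>t. t \<in> W \<Longrightarrow> gplus add (\<xi> t) (\<xi> t) = \<xi> t"
  shows "\<exists>\<zeta>\<in>K. (\<forall>t\<in>W. \<zeta> t = \<xi> t) \<and> (\<forall>t. gplus add (\<zeta> t) (\<zeta> t) = \<zeta> t)"
proof -
  let ?M = "{\<eta> \<in> K. \<forall>t\<in>W. \<eta> t = \<xi> t}"
  have "lim_closed flim ?M"
    unfolding lim_closed_def
  proof (intro allI impI)
    fix U assume U: "is_ultrafilter U" and M: "\<forall>\<^sub>F \<eta> in U. \<eta> \<in> ?M"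
    have "\<forall>\<^sub>F \<eta> in U. \<eta> \<in> K"
      using M by eventually_elim simp
    moreover have "\<forall>\<^sub>F \<eta> in U. \<eta> t = \<xi> t" if "t \<in> W" for t
      using M by eventually_elim (use that in simp)
    ultimately show "flim U \<in> ?M"
      using lim_closedD[OF K_lim_closed U] flim_const[OF U] by simp
  qed
  then have "\<exists>\<zeta>\<in>?M. \<forall>t. gplus add (\<zeta> t) (\<zeta> t) = \<zeta> t"
    by (intro K_idempotent) (use \<xi> in \<open>auto simp: K_gadd gadd_def idem\<close>)
  then show ?thesis
    by blast
qed

text \<open>
  Adding \<open>\<xi> (par t)\<close> on the right is continuous, so absorbing it on the right cuts out a closed
  subsemigroup; path sums taken in the two possible orders then give absorption on either side.
\<close>

lemma ordered_extension:
  assumes "\<xi>0 \<in> K" and "ordered_on W \<xi>0" and up: "\<And>t. t \<in> W \<Longrightarrow> par t \<in> W"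
  shows "\<exists>\<zeta>\<in>K. ordered_on {t. par t \<in> W} \<zeta>"
proof -
  \<comment> \<open>All labels are first made idempotent, without changes on \<open>W\<close>, so
    that path sums stay in \<open>K\<close>.\<close>
  obtain \<xi> where \<xi>: "\<xi> \<in> K" and eq0: "\<And>t. t \<in> W \<Longrightarrow> \<xi> t = \<xi>0 t"
    and idem: "\<And>t. gplus add (\<xi> t) (\<xi> t) = \<xi> t"
    using idempotent_extension[where W = W, OF assms(1) ordered_onD(1)[OF assms(2)]] by blast
  have ord: "ordered_on W \<xi>"
    using assms(2) up by (simp add: ordered_on_def eq0)
  obtain N where N: "\<And>t. (par ^^ N) t = r"
    using finite_height[OF tree] by blast
  \<comment> \<open>One step beyond \<open>N\<close>, so that the first summand can always be split
    off.\<close>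
  have N': "(par ^^ Suc N) t = r" for t
    using N[of "par t"] by (simp add: funpow_swap1)
  note assoc = gplus_assoc[OF semigroup K_gammaS K_gammaS]

  \<comment> \<open>At a node with parent in \<open>W\<close> this is \<xi> t + \<xi> (par t), which
    absorbs the idempotent \<xi> (par t) on the right. So \<open>p\<close> shows that
    \<open>?M\<close> is nonempty.\<close>
  define p where "p = pathsum (gplus add) par \<xi> (Suc N)"
  have p: "p \<in> K"
    unfolding p_def using \<xi> idem N' by (intro K_pathsum) auto
  have p_W: "pathsum (gplus add) par \<xi> n t = \<xi> t" if "t \<in> W" for t n
    using up ordered_onD(2)[OF ord] that by (rule pathsum_absorb)
  have p_W': "p t = gplus add (\<xi> t) (\<xi> (par t))" if "par t \<in> W" for t
    by (simp add: p_def p_W[OF that])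
  let ?M = "{\<eta> \<in> K. (\<forall>t\<in>W. \<eta> t = \<xi> t) \<and>
    (\<forall>t. par t \<in> W \<longrightarrow> gplus add (\<eta> t) (\<xi> (par t)) = \<eta> t)}"
  have "lim_closed flim ?M"
    unfolding lim_closed_def
  proof (intro allI impI)
    fix U assume U: "is_ultrafilter U" and M: "\<forall>\<^sub>F \<eta> in U. \<eta> \<in> ?M"
    have "\<forall>\<^sub>F \<eta> in U. \<eta> \<in> K"
      using M by eventually_elim simp
    moreover have "\<forall>\<^sub>F \<eta> in U. \<eta> t = \<xi> t" if "t \<in> W" for t
      using M by eventually_elim (use that in simp)
    moreover have "\<forall>\<^sub>F \<eta> in U. gplus add (\<eta> t) (\<xi> (par t)) = \<eta> t" if "par t \<in> W" for t
      using M by eventually_elim (use that in simp)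
    ultimately show "flim U \<in> ?M"
      using lim_closedD[OF K_lim_closed U] flim_const[OF U] gplus_flim_absorb[where U = U]
      by simp
  qed
  moreover have "p \<in> ?M"
    using p p_W p_W' assoc[OF \<xi> \<xi>] idem by (simp add: p_def del: pathsum.simps)
  moreover have "gadd add \<eta> \<eta>' \<in> ?M" if "\<eta> \<in> ?M" "\<eta>' \<in> ?M" for \<eta> \<eta>'
    using that assoc[of \<eta>' \<xi>] \<xi> by (auto simp: K_gadd gadd_def idem)
  ultimately obtain \<zeta> where \<zeta>: "\<zeta> \<in> K" "\<And>t. t \<in> W \<Longrightarrow> \<zeta> t = \<xi> t"
      "\<And>t. par t \<in> W \<Longrightarrow> gplus add (\<zeta> t) (\<xi> (par t)) = \<zeta> t"
      "\<And>t. gplus add (\<zeta> t) (\<zeta> t) = \<zeta> t"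
    using K_idempotent[of ?M] by blast

  \<comment> \<open>Summation in the opposite order gives \<xi> (par t) + \<zeta> t at a node with
    parent in \<open>W\<close>. Idempotence of the first summand yields absorption on the left;
    absorption on the right is inherited from \<zeta>.\<close>
  define q where "q = pathsum (\<lambda>U V. gplus add V U) par \<zeta> (Suc N)"
  have q: "q \<in> K"
    unfolding q_def using \<zeta> N' by (intro K_pathsum) auto
  have q_W: "pathsum (\<lambda>U V. gplus add V U) par \<zeta> n t = \<xi> t" if "t \<in> W" for t n
  proof -
    have "pathsum (\<lambda>U V. gplus add V U) par \<zeta> n t = \<zeta> t"
    proof (rule pathsum_absorb[OF up _ that])
      show "gplus add (\<zeta> (par t)) (\<zeta> t) = \<zeta> t" if "t \<in> W" for t
        using that \<zeta>(2) up ordered_onD(3)[OF ord] by simp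
    qed
    then show ?thesis
      using \<zeta>(2) that by simp
  qed
  have "ordered_on {t. par t \<in> W} q"
    unfolding ordered_on_def
  proof safe
    fix t assume t: "par t \<in> W"
    define a z where "a = \<xi> (par t)" and "z = \<zeta> t"
    have qt: "q t = gplus add a z" and qp: "q (par t) = a"
      using q_W[OF t] by (simp_all add: q_def a_def z_def del: pathsum.simps(2))
        (simp add: q_W[OF t])
    have rel: "gplus add z a = z" "gplus add z z = z" "gplus add a a = a"
      using \<zeta>(3,4) idem t by (simp_all add: a_def z_def)
    have az: "a \<in> gammaS add" "z \<in> gammaS add"
      using \<xi> \<zeta>(1) by (simp_all add: a_def z_def K_gammaS)
    note assoc' = gplus_assoc[OF semigroup]
    show "gplus add (q t) (q (par t)) = q t"
      unfolding qt qp by (simp add: assoc' az rel)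
    show "gplus add (q (par t)) (q t) = q t"
      unfolding qt qp by (simp add: rel flip: assoc'[OF az])
    \<comment> \<open>In a + z + a + z the inner z + a collapses to z.\<close>
    have "gplus add (gplus add a z) (gplus add a z) = gplus add a (gplus add (gplus add z a) z)"
      by (simp add: assoc' az gplus_gammaS semigroup)
    then show "gplus add (q t) (q t) = q t"
      by (simp add: qt rel)
  qed
  with q show ?thesis
    by blast
qed

text \<open>Induction on the distance from the root: the nodes with \<open>(par ^^ n) t = r\<close>
  are those within distance \<open>n\<close>, and \<open>ordered_extension\<close> adds one level.
  On the whole tree, associativity carries absorption from parents to all ancestors.\<close>

theorem ordered_idempotents:
  assumes "K \<noteq> {}"
  obtains \<xi> where "\<xi> \<in> K"
    and "\<And>s t. tree_le par s t \<Longrightarrow> gplus add (\<xi> s) (\<xi> t) = \<xi> s \<and> gplus add (\<xi> t) (\<xi> s) = \<xi> s"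
proof -
  have level: "\<exists>\<xi>\<in>K. ordered_on {t. (par ^^ n) t = r} \<xi>" for n
  proof (induction n)
    case 0
    obtain \<xi> where "\<xi> \<in> K"
      using assms by blast
    then obtain \<zeta> where "\<zeta> \<in> K" "\<And>t. gplus add (\<zeta> t) (\<zeta> t) = \<zeta> t"
      using idempotent_extension[of \<xi> "{}"] by auto
    \<comment> \<open>The root is its own parent, so idempotence is all that is asked there.\<close>
    then show ?case
      using tree by (auto simp: ordered_on_def rooted_tree_def)
  next
    case (Suc n)
    then obtain \<xi> where "\<xi> \<in> K" "ordered_on {t. (par ^^ n) t = r} \<xi>"
      by blast
    then have "\<exists>\<zeta>\<in>K. ordered_on {t. par t \<in> {t. (par ^^ n) t = r}} \<zeta>"
      by (rule ordered_extension)
        (use tree in \<open>auto simp: rooted_tree_def simp flip: funpow_swap1\<close>)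
    then show ?case
      by (simp add: funpow_swap1)
  qed
  obtain N where "\<And>t. (par ^^ N) t = r"
    using finite_height[OF tree] by blast
  then obtain \<xi> where \<xi>: "\<xi> \<in> K" and ord: "ordered_on UNIV \<xi>"
    using level[of N] by auto
  note ordD = ordered_onD[OF ord UNIV_I]
  have "gplus add (\<xi> s) (\<xi> t) = \<xi> s \<and> gplus add (\<xi> t) (\<xi> s) = \<xi> s" if "tree_le par s t" for s t
    using that
  proof (induction rule: tree_le_induct)
    case (step s)
    note assoc = gplus_assoc[OF semigroup K_gammaS[OF \<xi>] K_gammaS[OF \<xi>]]
    have "gplus add (gplus add (\<xi> s) (\<xi> (par s))) (\<xi> t) = \<xi> s"
      unfolding assoc by (simp add: step ordD)
    moreover have "gplus add (\<xi> t) (gplus add (\<xi> (par s)) (\<xi> s)) = \<xi> s"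
      unfolding assoc[symmetric] by (simp add: step ordD)
    ultimately show ?case
      by (simp add: ordD)
  qed (use ordD in simp)
  with \<xi> that show thesis
    by blast
qed

end

section \<open>Minima of chains\<close>

text \<open>If \<open>u\<close> is below the minimum, it is below \<open>t\<close>; otherwise
  \<open>t\<close> and \<open>u\<close> are ancestors of the minimum, hence comparable.\<close>

lemma comparable_tmin_right:
  assumes "comparable par s t" and "comparable par (tmin par s t) u"
  shows "comparable par t u"
proof -
  have "tree_le par (tmin par s t) t"
    by (simp add: tmin_def)
  with assms(2) show ?thesis
    unfolding comparable_def by (meson ancestors_comparable tree_le_trans)
qed

lemma comparable_tmin_left:
  assumes "comparable par s t" and "comparable par (tmin par s t) u"
  shows "comparable par s u"
proof -
  have "tree_le par (tmin par s t) s"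
    using assms(1) by (auto simp: tmin_def comparable_def)
  with assms(2) show ?thesis
    unfolding comparable_def by (meson ancestors_comparable tree_le_trans)
qed

lemma tmin_assoc:
  assumes "rooted_tree r par" and "comparable par s t" and "comparable par t u" and "comparable par s u"
  shows "tmin par (tmin par s t) u = tmin par s (tmin par t u)"
  using assms tree_le_antisym[OF assms(1)] unfolding tmin_def comparable_def
  by (auto dest: tree_le_trans)

lemma psum_snoc: "xs \<noteq> [] \<Longrightarrow> psum add (xs @ [y]) = Option.bind (psum add xs) (\<lambda>a. add a y)"
  by (cases xs) auto

context regressive_tree_action
begin

section \<open>Equivalence of the finitary statements\<close>

text \<open>The map \<open>x 0\<close> and sums with a single term give the finitary
  property.\<close>

lemma infinitary_imp_ramsey:
  assumes "infinitary_ramsey par add St F f"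
  shows "ramsey_action par add St F f"
  unfolding ramsey_action_def
proof (intro conjI ballI allI impI regressive)
  fix S0 :: "'s set" and c :: "'s \<Rightarrow> nat" and F0
  assume fin: "finite S0" "finite (range c)" "finite F0" and F0: "F0 \<subseteq> F"
  define \<psi>F :: "('t \<Rightarrow> 's) list \<Rightarrow> ('s \<Rightarrow> 's) set" where "\<psi>F xs = F0" for xs
  \<comment> \<open>The ranges serve admissibility; on the empty list the value is
    \<open>S0\<close>.\<close>
  define \<psi>S where "\<psi>S xs = S0 \<union> (\<Union>y\<in>set xs. \<Union>\<tau>\<in>F0. range (\<tau> \<circ> y))" for xs :: "('t \<Rightarrow> 's) list"
  have adm: "admissible F \<psi>F \<psi>S"
    using fin F0 nth_mem by (fastforce simp: admissible_def \<psi>F_def \<psi>S_def)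
  from assms[unfolded infinitary_ramsey_def, THEN spec, THEN spec, THEN spec, THEN mp, OF fin(2),
      THEN mp, OF adm]
  obtain x g where x: "\<forall>n t. x n t \<in> St t \<inter> phi UNIV add (\<psi>S (map x [0..<n]))"
    and g: "\<forall>(l::nat) (n :: nat \<Rightarrow> nat) (ts :: nat \<Rightarrow> 't) (\<tau>s :: nat \<Rightarrow> 's \<Rightarrow> 's) t.
       (\<forall>i<l. n i < n (Suc i)) \<longrightarrow>
       (\<forall>i\<le>l. \<tau>s i \<in> \<psi>F (map x [0..<n i])) \<longrightarrow>
       (\<forall>i\<le>l. \<forall>j\<le>l. tree_le par (f (\<tau>s i) (ts i)) (f (\<tau>s j) (ts j)) \<or>
                      tree_le par (f (\<tau>s j) (ts j)) (f (\<tau>s i) (ts i))) \<longrightarrow>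
       (\<exists>i\<le>l. t = f (\<tau>s i) (ts i)) \<longrightarrow>
       (\<forall>i\<le>l. tree_le par t (f (\<tau>s i) (ts i))) \<longrightarrow>
       (\<exists>s. psum add (map (\<lambda>i. \<tau>s i (x (n i) (ts i))) [0..<Suc l]) = Some s \<and> c s = g t)"
    by (elim exE conjE) (rule that; assumption)
  have "c (\<tau> (x 0 t)) = g (f \<tau> t)" if "\<tau> \<in> F0" for \<tau> t
    using g[rule_format, of 0 "\<lambda>_. 0" "\<lambda>_. \<tau>" "\<lambda>_. t" "f \<tau> t"] that by (simp add: \<psi>F_def)
  moreover have "x 0 t \<in> St t \<inter> phi UNIV add S0" for t
    using x[THEN spec, THEN spec, of 0 t] by (simp add: \<psi>S_def)
  ultimately show "\<exists>x. (\<forall>t. x t \<in> St t \<inter> phi UNIV add S0) \<and>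
      (\<exists>g. \<forall>\<tau>\<in>F0. \<forall>t. c (\<tau> (x t)) = g (f \<tau> t))"
    by blast
qed

lemma ultrafilter_colours:
  assumes "\<xi> \<in> K" and "finite (range c)"
  obtains g where "\<And>t. \<forall>\<^sub>F s in \<xi> t. c s = g t"
  using ultrafilter_finite_range[OF K_ultra[OF assms(1)] assms(2)] by metis

lemma eventually_equivariant:
  assumes "\<xi> \<in> K" and "\<tau> \<in> F" and "eventually P (\<xi> (f \<tau> t))"
  shows "\<forall>\<^sub>F s in \<xi> t. P (\<tau> s)"
  using assms by (simp add: eventually_filtermap flip: K_equivariant)

lemma eventually_phi:
  assumes "\<xi> \<in> K" and "finite A"
  shows "\<forall>\<^sub>F s in \<xi> t. s \<in> St t \<inter> phi UNIV add A"
proof -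
  have "\<forall>\<^sub>F s in \<xi> t. \<forall>a\<in>A. add a s \<noteq> None"
    using assms(2) gammaS_defined[OF K_gammaS[OF assms(1)]] by (intro eventually_ball_finite) auto
  moreover have "\<forall>\<^sub>F s in \<xi> t. s \<in> St t"
    using K_gamma_sub[OF assms(1)] gamma_subD by blast
  ultimately show ?thesis
    by eventually_elim (simp add: phi_def)
qed

lemma choose_along_ultrafilters:
  assumes "\<xi> \<in> K" and "\<And>t. \<forall>\<^sub>F s in \<xi> t. P t s"
  shows "\<exists>x. \<forall>t. P t (x t)"
proof -
  have "\<exists>s. P t s" for t
    using assms(2)[of t] K_ultra[OF assms(1), of t]
    by (intro eventually_happens') (simp_all add: is_ultrafilter_def)
  then show ?thesis
    by (intro choice allI)
qed

text \<open>Let \<open>g t\<close> be the colour typical for \<xi> t. By equivariance \<tau> carries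
  points typical for \<xi> t to points typical for \<open>\<xi> (f \<tau> t)\<close>, and finitely
  many such conditions on \<open>x t\<close> hold together.\<close>

lemma gamma_imp_ramsey:
  assumes "K \<noteq> {}"
  shows "ramsey_action par add St F f"
  unfolding ramsey_action_def
proof (intro conjI ballI allI impI regressive)
  fix S0 :: "'s set" and c :: "'s \<Rightarrow> nat" and F0
  assume fin: "finite S0" "finite (range c)" "finite F0" and F0: "F0 \<subseteq> F"
  obtain \<xi> where \<xi>: "\<xi> \<in> K"
    using assms by blast
  obtain g where g: "\<And>t. \<forall>\<^sub>F s in \<xi> t. c s = g t"
    using ultrafilter_colours[OF \<xi> fin(2)] by metis
  have "\<forall>\<^sub>F s in \<xi> t. \<forall>\<tau>\<in>F0. c (\<tau> s) = g (f \<tau> t)" for t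
  proof (rule eventually_ball_finite[OF fin(3)], rule)
    fix \<tau> assume "\<tau> \<in> F0"
    then show "\<forall>\<^sub>F s in \<xi> t. c (\<tau> s) = g (f \<tau> t)"
      using F0 by (intro eventually_equivariant[where \<tau> = \<tau>, OF \<xi> _ g]) auto
  qed
  then have "\<forall>\<^sub>F s in \<xi> t. s \<in> St t \<inter> phi UNIV add S0 \<and> (\<forall>\<tau>\<in>F0. c (\<tau> s) = g (f \<tau> t))" for t
    using eventually_phi[OF \<xi> fin(1)] by (rule eventually_conj[rotated])
  from choose_along_ultrafilters[OF \<xi> this]
  obtain x where "\<forall>t. x t \<in> St t \<inter> phi UNIV add S0 \<and> (\<forall>\<tau>\<in>F0. c (\<tau> (x t)) = g (f \<tau> t))" ..
  then show "\<exists>x. (\<forall>t. x t \<in> St t \<inter> phi UNIV add S0) \<and>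
      (\<exists>g. \<forall>\<tau>\<in>F0. \<forall>t. c (\<tau> (x t)) = g (f \<tau> t))"
    by blast
qed

section \<open>From Ramsey witnesses to an equivariant family of ultrafilters\<close>

definition ramsey_witnesses :: "'s set \<times> ('s \<Rightarrow> nat) \<times> ('s \<Rightarrow> 's) set \<Rightarrow> ('t \<Rightarrow> 's) set" where
  "ramsey_witnesses = (\<lambda>(S0, c, F0). {x. (\<forall>t. x t \<in> St t \<inter> phi UNIV add S0) \<and>
     (\<exists>g. \<forall>\<tau>\<in>F0. \<forall>t. c (\<tau> (x t)) = g (f \<tau> t))})"

text \<open>The witness sets are nonempty and form a filter base: two requirements are met jointly
  by uniting the finite sets and taking the product of the colourings.\<close>

lemma ramsey_witnesses_filter:
  assumes "ramsey_action par add St F f"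
  obtains U where "is_ultrafilter U"
    and "\<And>S0 c F0. finite S0 \<Longrightarrow> finite (range c) \<Longrightarrow> finite F0 \<Longrightarrow> F0 \<subseteq> F
      \<Longrightarrow> \<forall>\<^sub>F x in U. x \<in> ramsey_witnesses (S0, c, F0)"
proof -
  define I where "I = {(S0 :: 's set, c :: 's \<Rightarrow> nat, F0).
    finite S0 \<and> finite (range c) \<and> finite F0 \<and> F0 \<subseteq> F}"
  have I_iff: "(S0, c, F0) \<in> I \<longleftrightarrow> finite S0 \<and> finite (range c) \<and> finite F0 \<and> F0 \<subseteq> F" for S0 c F0
    by (simp add: I_def)
  define H where "H = (INF i\<in>I. principal (ramsey_witnesses i))"
  have "eventually P H \<longleftrightarrow> (\<exists>i\<in>I. eventually P (principal (ramsey_witnesses i)))" for P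
    unfolding H_def
  proof (rule eventually_INF_base)
    show "I \<noteq> {}"
      using I_iff[of "{}" "\<lambda>_. 0" "{}"] by auto
    fix i j assume "i \<in> I" "j \<in> I"
    then obtain S1 c1 F1 S2 c2 F2 where ij: "i = (S1, c1, F1)" "j = (S2, c2, F2)"
      and fin: "finite S1" "finite (range c1)" "finite F1" "F1 \<subseteq> F"
        "finite S2" "finite (range c2)" "finite F2" "F2 \<subseteq> F"
      by (cases i; cases j) (auto simp: I_iff)
    \<comment> \<open>The pair of colours is coded by one number; decoding \<open>g\<close> serves
      both colourings.\<close>
    define c where "c s = prod_encode (c1 s, c2 s)" for s
    have "range c \<subseteq> prod_encode ` (range c1 \<times> range c2)"
      by (auto simp: c_def)
    then have "finite (range c)"
      using fin by (meson finite_SigmaI finite_imageI finite_subset)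
    moreover have "x \<in> ramsey_witnesses i \<inter> ramsey_witnesses j"
      if x: "x \<in> ramsey_witnesses (S1 \<union> S2, c, F1 \<union> F2)" for x
    proof -
      obtain g where g: "\<And>\<tau> t. \<tau> \<in> F1 \<union> F2 \<Longrightarrow> c (\<tau> (x t)) = g (f \<tau> t)"
        using x by (auto simp: ramsey_witnesses_def)
      have "c1 (\<tau> (x t)) = fst (prod_decode (g (f \<tau> t)))" "c2 (\<tau> (x t)) = snd (prod_decode (g (f \<tau> t)))"
        if "\<tau> \<in> F1 \<union> F2" for \<tau> t
        using g[OF that, of t, symmetric] by (simp_all add: c_def)
      then have "\<exists>g. \<forall>\<tau>\<in>F1. \<forall>t. c1 (\<tau> (x t)) = g (f \<tau> t)"
        and "\<exists>g. \<forall>\<tau>\<in>F2. \<forall>t. c2 (\<tau> (x t)) = g (f \<tau> t)"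
        by (auto intro: exI[of _ "\<lambda>t. fst (prod_decode (g t))"] exI[of _ "\<lambda>t. snd (prod_decode (g t))"])
      then show ?thesis
        using x unfolding ij ramsey_witnesses_def by (auto simp: phi_def)
    qed
    ultimately show "\<exists>k\<in>I. principal (ramsey_witnesses k)
        \<le> inf (principal (ramsey_witnesses i)) (principal (ramsey_witnesses j))"
      using fin by (intro bexI[of _ "(S1 \<union> S2, c, F1 \<union> F2)"]) (auto simp: I_iff)
  qed
  moreover have "ramsey_witnesses i \<noteq> {}" if "i \<in> I" for i
    using assms that by (cases i) (auto simp: I_iff ramsey_action_def ramsey_witnesses_def)
  ultimately have "H \<noteq> bot"
    unfolding trivial_limit_def eventually_principal by auto
  then obtain U where U: "is_ultrafilter U" "U \<le> H"
    by (rule ultrafilter_exists)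
  have "\<forall>\<^sub>F x in U. x \<in> ramsey_witnesses i" if "i \<in> I" for i
  proof -
    have "U \<le> principal (ramsey_witnesses i)"
      using U(2) INF_lower[OF that] unfolding H_def by (rule order_trans)
    then show ?thesis
      by (simp add: le_principal)
  qed
  with U(1) that show thesis
    by (simp add: I_iff)
qed

text \<open>
  The Ramsey property only controls the ultrafilters \<open>\<tau> (\<eta> t)\<close>, which depend on \<open>f \<tau> t\<close> alone.
  So the fixed point is defined by them where possible; this agrees with \<open>\<eta>\<close> if \<open>id \<in> F\<close>, and is
  equivariant if spines are compatible with composition.
\<close>

lemma ramsey_imp_gamma:
  assumes "ramsey_action par add St F f"
    and coherent: "(id \<in> F \<and> f id = id) \<or> (\<forall>\<sigma>\<in>F. \<forall>\<tau>\<in>F. f (\<sigma> \<circ> \<tau>) = f \<sigma> \<circ> f \<tau>)"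
  shows "K \<noteq> {}"
proof -
  obtain U where U: "is_ultrafilter U" and wit: "\<And>S0 c F0. finite S0 \<Longrightarrow> finite (range c)
      \<Longrightarrow> finite F0 \<Longrightarrow> F0 \<subseteq> F \<Longrightarrow> \<forall>\<^sub>F x in U. x \<in> ramsey_witnesses (S0, c, F0)"
    using ramsey_witnesses_filter[OF assms(1)] by metis
  \<comment> \<open>The limit of \<open>x t\<close> along \<open>U\<close>.\<close>
  define \<eta> where "\<eta> t = filtermap (\<lambda>x. x t) U" for t
  have \<eta>: "\<eta> t \<in> gamma_sub add (St t)" for t
  proof -
    have "\<forall>\<^sub>F x in U. x t \<in> St t \<and> add a (x t) \<noteq> None" for a
      using wit[of "{a}" "\<lambda>_. 0" "{}"]
      by (rule eventually_mono) (auto simp: ramsey_witnesses_def phi_def)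
    then show ?thesis
      using ultrafilter_filtermap[OF U, of "\<lambda>x. x t"]
      by (simp add: \<eta>_def gamma_sub_def gammaS_def eventually_filtermap eventually_conj_iff)
  qed
  have \<eta>_eq: "filtermap \<sigma> (\<eta> s) = filtermap \<tau> (\<eta> t)"
    if "\<sigma> \<in> F" "\<tau> \<in> F" "f \<sigma> s = f \<tau> t" for \<sigma> \<tau> s t
  proof -
    have "(\<forall>\<^sub>F x in U. P (\<sigma> (x s))) \<longleftrightarrow> (\<forall>\<^sub>F x in U. P (\<tau> (x t)))" for P
    proof -
      \<comment> \<open>The indicator of \<open>P\<close> is a two-colouring, and equal spine values
        force equal colours at \<sigma> (x s) and \<tau> (x t).\<close>
      define c :: "'s \<Rightarrow> nat" where "c s = (if P s then 1 else 0)" for s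
      have "finite (range c)"
        by (rule finite_subset[of _ "{0, 1}"]) (auto simp: c_def)
      then have "\<forall>\<^sub>F x in U. x \<in> ramsey_witnesses ({}, c, {\<sigma>, \<tau>})"
        using that by (intro wit) auto
      then have "\<forall>\<^sub>F x in U. c (\<sigma> (x s)) = c (\<tau> (x t))"
        by (rule eventually_mono) (use that(3) in \<open>auto simp: ramsey_witnesses_def\<close>)
      then show ?thesis
        by (rule eventually_cong) (simp add: c_def split: if_splits)
    qed
    then show ?thesis
      by (simp add: \<eta>_def filter_eq_iff eventually_filtermap)
  qed
  have map_sub: "filtermap \<tau> (\<eta> t) \<in> gamma_sub add (St (f \<tau> t))" if "\<tau> \<in> F" for \<tau> t
  proof -
    have "\<forall>\<^sub>F s in \<eta> t. s \<in> St t"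
      using \<eta> gamma_subD by blast
    then have "\<forall>\<^sub>F s in \<eta> t. \<tau> s \<in> St (f \<tau> t)"
      by (rule eventually_mono) (rule spine_maps[OF that])
    then show ?thesis
      using filtermap_gammaS[OF F_End[OF that]] \<eta>[of t]
      by (simp add: gamma_sub_def eventually_filtermap)
  qed
  \<comment> \<open>By \<open>\<eta>_eq\<close> the chosen value does not depend on \<tau> and
    \<open>t\<close>.\<close>
  define \<zeta> where "\<zeta> u = (if \<exists>\<tau>\<in>F. \<exists>t. f \<tau> t = u
      then SOME V. \<exists>\<tau>\<in>F. \<exists>t. f \<tau> t = u \<and> V = filtermap \<tau> (\<eta> t) else \<eta> u)" for u
  have \<zeta>_image: "\<zeta> (f \<tau> t) = filtermap \<tau> (\<eta> t)" if "\<tau> \<in> F" for \<tau> t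
  proof -
    have ex: "\<exists>\<tau>'\<in>F. \<exists>t'. f \<tau>' t' = f \<tau> t"
      using that by blast
    have "\<exists>V. \<exists>\<tau>'\<in>F. \<exists>t'. f \<tau>' t' = f \<tau> t \<and> V = filtermap \<tau>' (\<eta> t')"
      using that by blast
    from someI_ex[OF this] show ?thesis
      unfolding \<zeta>_def if_P[OF ex] using \<eta>_eq that by metis
  qed
  have \<zeta>_other: "\<zeta> u = \<eta> u" if "\<not> (\<exists>\<tau>\<in>F. \<exists>t. f \<tau> t = u)" for u
    using that by (simp add: \<zeta>_def)
  have "\<zeta> \<in> K"
  proof (rule K_I)
    fix u
    show "\<zeta> u \<in> gamma_sub add (St u)"
      using \<zeta>_image \<zeta>_other map_sub \<eta> by metis
    fix \<sigma> assume \<sigma>: "\<sigma> \<in> F"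
    show "filtermap \<sigma> (\<zeta> u) = \<zeta> (f \<sigma> u)"
    proof (cases "\<exists>\<tau>\<in>F. \<exists>t. f \<tau> t = u")
      case False
      then show ?thesis
        using \<zeta>_image[OF \<sigma>] \<zeta>_other by simp
    next
      case True
      then obtain \<tau> t where \<tau>: "\<tau> \<in> F" "f \<tau> t = u"
        by blast
      from coherent show ?thesis
      proof
        assume "id \<in> F \<and> f id = id"
        then have "\<zeta> u = \<eta> u"
          using \<zeta>_image[of id u] by (simp add: filtermap_ident id_def)
        then show ?thesis
          using \<zeta>_image[OF \<sigma>] by simp
      next
        assume "\<forall>\<sigma>\<in>F. \<forall>\<tau>\<in>F. f (\<sigma> \<circ> \<tau>) = f \<sigma> \<circ> f \<tau>"
        \<comment> \<open>Both sides turn out to be the image of \<eta> t under \<sigma> \<circ>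
          \<tau>.\<close>
        then have "f (\<sigma> \<circ> \<tau>) t = f \<sigma> u"
          using \<sigma> \<tau> by simp
        moreover have "\<sigma> \<circ> \<tau> \<in> F"
          using action \<sigma> \<tau> unfolding tree_action_def by blast
        ultimately have "\<zeta> (f \<sigma> u) = filtermap (\<sigma> \<circ> \<tau>) (\<eta> t)"
          using \<zeta>_image by metis
        then show ?thesis
          using \<zeta>_image[OF \<tau>(1), of t] \<tau>(2) by (simp add: filtermap_filtermap comp_def)
      qed
    qed
  qed
  then show ?thesis
    by blast
qed

section \<open>The infinitary statement\<close>

text \<open>
  Here \<open>s\<close> is a partial sum over a chain with least element \<open>t\<close>.
\<close>

definition good :: "('t \<Rightarrow> 's filter) \<Rightarrow> ('s \<Rightarrow> nat) \<Rightarrow> ('t \<Rightarrow> nat) \<Rightarrow> 's \<Rightarrow> 't \<Rightarrow> bool" where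
  "good \<xi> c g s t \<longleftrightarrow> c s = g t \<and>
     (\<forall>u. comparable par t u \<longrightarrow> (\<forall>\<^sub>F y in \<xi> u. c (the (add s y)) = g (tmin par t u)))"

section \<open>Partial sums with typical colours and the recursive choice\<close>

context
  fixes \<xi> :: "'t \<Rightarrow> 's filter" and c :: "'s \<Rightarrow> nat" and g :: "'t \<Rightarrow> nat"
  assumes \<xi>: "\<xi> \<in> K" and g: "\<And>t. \<forall>\<^sub>F s in \<xi> t. c s = g t"
    and ordered: "\<forall>s t. tree_le par s t \<longrightarrow>
      gplus add (\<xi> s) (\<xi> t) = \<xi> s \<and> gplus add (\<xi> t) (\<xi> s) = \<xi> s"
begin

lemma gplus_comparable: "comparable par s t \<Longrightarrow> gplus add (\<xi> s) (\<xi> t) = \<xi> (tmin par s t)"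
  using ordered by (auto simp: comparable_def tmin_def)

text \<open>For comparable nodes, \<xi> u + \<xi> v is \<xi> at the smaller one, whose typical
  colour is known. Unfolding the sum gives the condition for almost all \<open>y\<close>, and the
  finitely many \<open>v\<close> are treated together.\<close>

lemma eventually_good: "\<forall>\<^sub>F y in \<xi> u. good \<xi> c g y u"
proof -
  have "\<forall>\<^sub>F y in \<xi> u. comparable par u v \<longrightarrow> (\<forall>\<^sub>F z in \<xi> v. c (the (add y z)) = g (tmin par u v))" for v
  proof (cases "comparable par u v")
    case True
    have "\<forall>\<^sub>F s in gplus add (\<xi> u) (\<xi> v). c s = g (tmin par u v)"
      unfolding gplus_comparable[OF True] by (rule g)
    then show ?thesis
      unfolding eventually_gplus by eventually_elim simp
  qed simp
  then show ?thesis
    unfolding good_def by (intro eventually_conj g eventually_all_finite)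
qed

text \<open>The condition on s + y at \<open>v\<close> comes from that on \<open>s\<close> at the
  minimum of \<open>u\<close> and \<open>v\<close>, since \<xi> u + \<xi> v is \<xi> at this minimum
  and s + (y + z) = (s + y) + z.\<close>

lemma good_extend:
  assumes good: "good \<xi> c g s t" and tu: "comparable par t u"
  shows "\<forall>\<^sub>F y in \<xi> u. add s y \<noteq> None \<and> good \<xi> c g (the (add s y)) (tmin par t u)"
proof -
  note defined = gammaS_defined[OF K_gammaS[OF \<xi>]]
  have "\<forall>\<^sub>F y in \<xi> u. comparable par (tmin par t u) v \<longrightarrow>
      (\<forall>\<^sub>F z in \<xi> v. c (the (add (the (add s y)) z)) = g (tmin par (tmin par t u) v))" for v
  proof (cases "comparable par (tmin par t u) v")
    case True
    have uv: "comparable par u v" and tv: "comparable par t v"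
      using comparable_tmin_right[OF tu True] comparable_tmin_left[OF tu True] by auto
    then have "comparable par t (tmin par u v)"
      using tu by (simp add: tmin_def)
    then have "\<forall>\<^sub>F w in gplus add (\<xi> u) (\<xi> v). c (the (add s w)) = g (tmin par (tmin par t u) v)"
      using good unfolding gplus_comparable[OF uv] tmin_assoc[OF tree tu uv tv] good_def by blast
    then have "\<forall>\<^sub>F y in \<xi> u. \<forall>\<^sub>F z in \<xi> v. c (the (add s (the (add y z)))) = g (tmin par (tmin par t u) v)"
      unfolding eventually_gplus .
    with defined[of s u] show ?thesis
    proof eventually_elim
      case (elim y)
      then obtain w where w: "add s y = Some w"
        by auto
      from elim(2) defined[of w v] have "\<forall>\<^sub>F z in \<xi> v. c (the (add w z)) = g (tmin par (tmin par t u) v)"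
      proof eventually_elim
        case (elim z)
        then obtain q where q: "add w z = Some q"
          by auto
        then obtain v' where "add y z = Some v'" "add s v' = Some q"
          using partial_assoc[OF semigroup w] by metis
        with elim(1) q show ?case
          by simp
      qed
      then show ?case
        by (simp add: w)
    qed
  qed simp
  moreover have "\<forall>\<^sub>F y in \<xi> u. c (the (add s y)) = g (tmin par t u)"
    using good tu by (simp add: good_def)
  ultimately show ?thesis
    unfolding good_def by (intro eventually_conj defined eventually_all_finite)
qed

text \<open>
  One step of the recursive choice: \<open>D\<close> is the finite set of the partial sums so far, each with
  the least element of its chain.
\<close>

lemma good_step:
  assumes D: "finite D" "\<And>s u. (s, u) \<in> D \<Longrightarrow> good \<xi> c g s u"
    and G: "finite G" "G \<subseteq> F" and A: "finite A"
  shows "\<exists>x D'. finite D' \<and> (\<forall>s u. (s, u) \<in> D' \<longrightarrow> good \<xi> c g s u) \<and> D \<subseteq> D' \<and>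
    (\<forall>t. x t \<in> St t \<inter> phi UNIV add A) \<and>
    (\<forall>\<tau>\<in>G. \<forall>t. (\<tau> (x t), f \<tau> t) \<in> D' \<and>
      (\<forall>s u. (s, u) \<in> D \<longrightarrow> comparable par u (f \<tau> t) \<longrightarrow>
        (\<exists>v. add s (\<tau> (x t)) = Some v \<and> (v, tmin par u (f \<tau> t)) \<in> D')))"
proof -
  \<comment> \<open>\<open>Ext y t\<close> says that \<open>y\<close> may serve as a summand at node
    \<open>t\<close>: alone, and after each sum in \<open>D\<close> whose minimum is comparable with
    \<open>t\<close>.\<close>
  define Ext where "Ext y t \<longleftrightarrow> good \<xi> c g y t \<and> (\<forall>(s, u)\<in>D. comparable par u t \<longrightarrow>
    add s y \<noteq> None \<and> good \<xi> c g (the (add s y)) (tmin par u t))" for y t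
  have Ext: "\<forall>\<^sub>F y in \<xi> t. Ext y t" for t
  proof -
    have "\<forall>\<^sub>F y in \<xi> t. \<forall>p\<in>D. case p of (s, u) \<Rightarrow> comparable par u t \<longrightarrow>
        add s y \<noteq> None \<and> good \<xi> c g (the (add s y)) (tmin par u t)"
    proof (intro eventually_ball_finite D(1) ballI)
      fix p assume "p \<in> D"
      then show "\<forall>\<^sub>F y in \<xi> t. case p of (s, u) \<Rightarrow> comparable par u t \<longrightarrow>
          add s y \<noteq> None \<and> good \<xi> c g (the (add s y)) (tmin par u t)"
        using good_extend[OF D(2)] by (cases p; cases "comparable par (snd p) t") auto
    qed
    then show ?thesis
      unfolding Ext_def by (intro eventually_conj eventually_good)
  qed
  have "\<forall>\<^sub>F s in \<xi> t. \<forall>\<tau>\<in>G. Ext (\<tau> s) (f \<tau> t)" for t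
  proof (rule eventually_ball_finite[OF G(1)], rule)
    fix \<tau> assume "\<tau> \<in> G"
    then show "\<forall>\<^sub>F s in \<xi> t. Ext (\<tau> s) (f \<tau> t)"
      using G(2) by (intro eventually_equivariant[where \<tau> = \<tau>, OF \<xi> _ Ext]) auto
  qed
  then have "\<forall>\<^sub>F s in \<xi> t. s \<in> St t \<inter> phi UNIV add A \<and> (\<forall>\<tau>\<in>G. Ext (\<tau> s) (f \<tau> t))" for t
    using eventually_phi[OF \<xi> A] by (rule eventually_conj[rotated])
  from choose_along_ultrafilters[OF \<xi> this]
  obtain x where x: "\<forall>t. x t \<in> St t \<inter> phi UNIV add A \<and> (\<forall>\<tau>\<in>G. Ext (\<tau> (x t)) (f \<tau> t))" ..
  define Y where "Y = (\<lambda>(\<tau>, t). (\<tau> (x t), f \<tau> t)) ` (G \<times> UNIV)"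
  define Z where "Z = {((s, u), (y, t)) \<in> D \<times> Y. comparable par u t}"
  \<comment> \<open>Old sums, new sums with one term, and old sums prolonged by a new term; on
    \<open>Z\<close> the additions are defined, so \<open>the\<close> is harmless.\<close>
  define D' where "D' = D \<union> Y \<union> (\<lambda>((s, u), (y, t)). (the (add s y), tmin par u t)) ` Z"
  have Y: "Ext y t" if "(y, t) \<in> Y" for y t
    using that x by (auto simp: Y_def)
  have "finite Y"
    using G by (simp add: Y_def)
  then have "finite Z"
    unfolding Z_def by (intro finite_subset[OF _ finite_cartesian_product[OF D(1)]]) auto
  then have "finite D'"
    using D(1) \<open>finite Y\<close> by (simp add: D'_def)
  moreover have "good \<xi> c g s u" if "(s, u) \<in> D'" for s u
    using that D(2) Y by (fastforce simp: D'_def Z_def Ext_def)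
  moreover have "\<exists>v. add s (\<tau> (x t)) = Some v \<and> (v, tmin par u (f \<tau> t)) \<in> D'"
    if "\<tau> \<in> G" "(s, u) \<in> D" "comparable par u (f \<tau> t)" for \<tau> t s u
  proof -
    have y: "(\<tau> (x t), f \<tau> t) \<in> Y"
      using that(1) by (auto simp: Y_def)
    then have "((s, u), (\<tau> (x t), f \<tau> t)) \<in> Z"
      using that by (simp add: Z_def)
    then have "(the (add s (\<tau> (x t))), tmin par u (f \<tau> t)) \<in> D'"
      unfolding D'_def by (intro UnI2) force
    moreover have "add s (\<tau> (x t)) \<noteq> None"
      using Y[OF y] that by (auto simp: Ext_def)
    ultimately show ?thesis
      by auto
  qed
  moreover have "(\<tau> (x t), f \<tau> t) \<in> D'" if "\<tau> \<in> G" for \<tau> t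
    using that by (auto simp: D'_def Y_def)
  moreover have "D \<subseteq> D'"
    by (auto simp: D'_def)
  ultimately show ?thesis
    using x by (intro exI[of _ x] exI[of _ D']) blast
qed

text \<open>Dependent choice over states made of the list of maps chosen so far and a finite set of
  good sums; \<open>good_step\<close> prolongs a state. \<open>D n\<close> collects sums whose last
  index is below \<open>n\<close>.\<close>

lemma infinitary_sequence:
  assumes "admissible F \<psi>F \<psi>S"
  shows "\<exists>x D. (\<forall>n t. x n t \<in> St t \<inter> phi UNIV add (\<psi>S (map x [0..<n]))) \<and>
    (\<forall>n s u. (s, u) \<in> D n \<longrightarrow> c s = g u) \<and> (\<forall>n. D n \<subseteq> D (Suc n)) \<and>
    (\<forall>n. \<forall>\<tau>\<in>\<psi>F (map x [0..<n]). \<forall>t. (\<tau> (x n t), f \<tau> t) \<in> D (Suc n) \<and>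
      (\<forall>s u. (s, u) \<in> D n \<longrightarrow> comparable par u (f \<tau> t) \<longrightarrow>
        (\<exists>v. add s (\<tau> (x n t)) = Some v \<and> (v, tmin par u (f \<tau> t)) \<in> D (Suc n))))"
proof -
  define P where "P n st \<longleftrightarrow> length (fst st) = n \<and> finite (snd st) \<and>
      (\<forall>s u. (s, u) \<in> snd st \<longrightarrow> good \<xi> c g s u)" for n and st :: "('t \<Rightarrow> 's) list \<times> ('s \<times> 't) set"
  define Q where "Q n st st' \<longleftrightarrow> (\<exists>x. fst st' = fst st @ [x] \<and> snd st \<subseteq> snd st' \<and>
      (\<forall>t. x t \<in> St t \<inter> phi UNIV add (\<psi>S (fst st))) \<and>
      (\<forall>\<tau>\<in>\<psi>F (fst st). \<forall>t. (\<tau> (x t), f \<tau> t) \<in> snd st' \<and>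
        (\<forall>s u. (s, u) \<in> snd st \<longrightarrow> comparable par u (f \<tau> t) \<longrightarrow>
          (\<exists>v. add s (\<tau> (x t)) = Some v \<and> (v, tmin par u (f \<tau> t)) \<in> snd st'))))"
    for n :: nat and st st' :: "('t \<Rightarrow> 's) list \<times> ('s \<times> 't) set"
  have "\<exists>st'. P (Suc n) st' \<and> Q n st st'" if st: "P n st" for n st
  proof -
    have "\<exists>x D'. finite D' \<and> (\<forall>s u. (s, u) \<in> D' \<longrightarrow> good \<xi> c g s u) \<and> snd st \<subseteq> D' \<and>
        (\<forall>t. x t \<in> St t \<inter> phi UNIV add (\<psi>S (fst st))) \<and>
        (\<forall>\<tau>\<in>\<psi>F (fst st). \<forall>t. (\<tau> (x t), f \<tau> t) \<in> D' \<and>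
          (\<forall>s u. (s, u) \<in> snd st \<longrightarrow> comparable par u (f \<tau> t) \<longrightarrow>
            (\<exists>v. add s (\<tau> (x t)) = Some v \<and> (v, tmin par u (f \<tau> t)) \<in> D')))"
      using st assms by (intro good_step) (auto simp: P_def admissible_def)
    then obtain x D' where "finite D' \<and> (\<forall>s u. (s, u) \<in> D' \<longrightarrow> good \<xi> c g s u)" and
      "snd st \<subseteq> D' \<and> (\<forall>t. x t \<in> St t \<inter> phi UNIV add (\<psi>S (fst st))) \<and>
        (\<forall>\<tau>\<in>\<psi>F (fst st). \<forall>t. (\<tau> (x t), f \<tau> t) \<in> D' \<and>
          (\<forall>s u. (s, u) \<in> snd st \<longrightarrow> comparable par u (f \<tau> t) \<longrightarrow>
            (\<exists>v. add s (\<tau> (x t)) = Some v \<and> (v, tmin par u (f \<tau> t)) \<in> D')))"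
      by blast
    then have "P (Suc n) (fst st @ [x], D') \<and> Q n st (fst st @ [x], D')"
      using st by (simp add: P_def Q_def)
    then show ?thesis
      by blast
  qed
  moreover have "P 0 ([], {})"
    by (simp add: P_def)
  ultimately obtain \<Sigma> where \<Sigma>: "\<And>n. P n (\<Sigma> n)" "\<And>n. Q n (\<Sigma> n) (\<Sigma> (Suc n))"
    using dependent_nat_choice[of P Q] by metis
  define x where "x n = last (fst (\<Sigma> (Suc n)))" for n
  have snoc: "fst (\<Sigma> (Suc n)) = fst (\<Sigma> n) @ [x n]" for n
    using \<Sigma>(2)[of n] by (auto simp: Q_def x_def)
  \<comment> \<open>The first component is the history at which \<psi>F and \<psi>S are
    evaluated.\<close>
  have prefix: "fst (\<Sigma> n) = map x [0..<n]" for n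
  proof (induction n)
    case 0
    then show ?case
      using \<Sigma>(1)[of 0] by (simp add: P_def)
  qed (simp add: snoc)
  have step: "snd (\<Sigma> n) \<subseteq> snd (\<Sigma> (Suc n)) \<and>
      (\<forall>t. x n t \<in> St t \<inter> phi UNIV add (\<psi>S (map x [0..<n]))) \<and>
      (\<forall>\<tau>\<in>\<psi>F (map x [0..<n]). \<forall>t. (\<tau> (x n t), f \<tau> t) \<in> snd (\<Sigma> (Suc n)) \<and>
        (\<forall>s u. (s, u) \<in> snd (\<Sigma> n) \<longrightarrow> comparable par u (f \<tau> t) \<longrightarrow>
          (\<exists>v. add s (\<tau> (x n t)) = Some v \<and> (v, tmin par u (f \<tau> t)) \<in> snd (\<Sigma> (Suc n)))))" for n
    using \<Sigma>(2)[of n] unfolding Q_def snoc prefix by simp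
  moreover have "c s = g u" if "(s, u) \<in> snd (\<Sigma> n)" for n s u
    using that \<Sigma>(1)[of n] by (simp add: P_def good_def)
  ultimately show ?thesis
    by (intro exI[of _ x] exI[of _ "\<lambda>n. snd (\<Sigma> n)"]) simp
qed

end

text \<open>An ordered idempotent family feeds the recursive choice. Each sum in question is
  recorded in \<open>D\<close> with the minimum of its chain, and its colour is the typical one
  there.\<close>

lemma gamma_imp_infinitary:
  assumes "K \<noteq> {}"
  shows "infinitary_ramsey par add St F f"
  unfolding infinitary_ramsey_def
proof (intro allI impI)
  fix c :: "'s \<Rightarrow> nat" and \<psi>F :: "('t \<Rightarrow> 's) list \<Rightarrow> ('s \<Rightarrow> 's) set"
    and \<psi>S :: "('t \<Rightarrow> 's) list \<Rightarrow> 's set"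
  assume c: "finite (range c)" and adm: "admissible F \<psi>F \<psi>S"
  obtain \<xi> where \<xi>: "\<xi> \<in> K" and ordered: "\<forall>s t. tree_le par s t \<longrightarrow>
      gplus add (\<xi> s) (\<xi> t) = \<xi> s \<and> gplus add (\<xi> t) (\<xi> s) = \<xi> s"
    using ordered_idempotents[OF assms] by blast
  obtain g where g: "\<And>t. \<forall>\<^sub>F s in \<xi> t. c s = g t"
    using ultrafilter_colours[OF \<xi> c] by metis
  from infinitary_sequence[OF \<xi> g ordered adm]
  obtain x D where x: "\<forall>n t. x n t \<in> St t \<inter> phi UNIV add (\<psi>S (map x [0..<n]))"
    and colour: "\<forall>n s u. (s, u) \<in> D n \<longrightarrow> c s = g u" and mono: "\<forall>n. D n \<subseteq> D (Suc n)"
    and step: "\<forall>n. \<forall>\<tau>\<in>\<psi>F (map x [0..<n]). \<forall>t. (\<tau> (x n t), f \<tau> t) \<in> D (Suc n) \<and>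
      (\<forall>s u. (s, u) \<in> D n \<longrightarrow> comparable par u (f \<tau> t) \<longrightarrow>
        (\<exists>v. add s (\<tau> (x n t)) = Some v \<and> (v, tmin par u (f \<tau> t)) \<in> D (Suc n)))"
    by (elim exE conjE) (rule that; assumption)
  have sums: "\<exists>s t. psum add (map (\<lambda>i. \<tau>s i (x (n i) (ts i))) [0..<Suc l]) = Some s \<and>
      (s, t) \<in> D (Suc (n l)) \<and> (\<exists>i\<le>l. t = f (\<tau>s i) (ts i)) \<and> (\<forall>i\<le>l. tree_le par t (f (\<tau>s i) (ts i)))"
    if "\<forall>i<l. n i < n (Suc i)" and "\<forall>i\<le>l. \<tau>s i \<in> \<psi>F (map x [0..<n i])"
      and "\<forall>i\<le>l. \<forall>j\<le>l. comparable par (f (\<tau>s i) (ts i)) (f (\<tau>s j) (ts j))"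
    for l and n :: "nat \<Rightarrow> nat" and \<tau>s :: "nat \<Rightarrow> 's \<Rightarrow> 's" and ts :: "nat \<Rightarrow> 't"
    using that
  proof (induction l)
    case 0
    then show ?case
      using step by simp
  next
    case (Suc l)
    then obtain s t where s: "psum add (map (\<lambda>i. \<tau>s i (x (n i) (ts i))) [0..<Suc l]) = Some s"
      and st: "(s, t) \<in> D (Suc (n l))" and t: "\<exists>i\<le>l. t = f (\<tau>s i) (ts i)"
        "\<forall>i\<le>l. tree_le par t (f (\<tau>s i) (ts i))"
      by auto
    define u where "u = f (\<tau>s (Suc l)) (ts (Suc l))"
    \<comment> \<open>A jump in the indices is bridged by the monotonicity of
      \<open>D\<close>.\<close>
    have "Suc (n l) \<le> n (Suc l)"
      using Suc.prems(1) by (simp add: Suc_leI)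
    then have "(s, t) \<in> D (n (Suc l))"
      using st lift_Suc_mono_le[of D] mono by blast
    moreover have tu: "comparable par t u"
      using t(1) Suc.prems(3) by (auto simp: u_def)
    moreover have "\<tau>s (Suc l) \<in> \<psi>F (map x [0..<n (Suc l)])"
      using Suc.prems(2) by simp
    ultimately obtain v where v: "add s (\<tau>s (Suc l) (x (n (Suc l)) (ts (Suc l)))) = Some v"
        "(v, tmin par t u) \<in> D (Suc (n (Suc l)))"
      using step unfolding u_def by blast
    have "psum add (map (\<lambda>i. \<tau>s i (x (n i) (ts i))) [0..<Suc l] @ [\<tau>s (Suc l) (x (n (Suc l)) (ts (Suc l)))]) = Some v"
      using s v(1) by (subst psum_snoc) (auto simp del: upt_Suc)
    moreover have "tree_le par (tmin par t u) t" "tree_le par (tmin par t u) u"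
      using tu by (auto simp: tmin_def comparable_def)
    then have "\<forall>i\<le>Suc l. tree_le par (tmin par t u) (f (\<tau>s i) (ts i))"
      using t(2) by (auto simp: le_Suc_eq u_def intro: tree_le_trans)
    moreover have "\<exists>i\<le>Suc l. tmin par t u = f (\<tau>s i) (ts i)"
      using t(1) unfolding tmin_def u_def by (metis le_Suc_eq)
    ultimately show ?case
      using v(2) by (intro exI[of _ v] exI[of _ "tmin par t u"]) simp
  qed
  show "\<exists>x. (\<forall>n t. x n t \<in> St t \<inter> phi UNIV add (\<psi>S (map x [0..<n]))) \<and>
      (\<exists>g. \<forall>l n ts \<tau>s t. (\<forall>i<l. n i < n (Suc i)) \<longrightarrow>
         (\<forall>i\<le>l. \<tau>s i \<in> \<psi>F (map x [0..<n i])) \<longrightarrow>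
         (\<forall>i\<le>l. \<forall>j\<le>l. tree_le par (f (\<tau>s i) (ts i)) (f (\<tau>s j) (ts j)) \<or>
                        tree_le par (f (\<tau>s j) (ts j)) (f (\<tau>s i) (ts i))) \<longrightarrow>
         (\<exists>i\<le>l. t = f (\<tau>s i) (ts i)) \<longrightarrow>
         (\<forall>i\<le>l. tree_le par t (f (\<tau>s i) (ts i))) \<longrightarrow>
         (\<exists>s. psum add (map (\<lambda>i. \<tau>s i (x (n i) (ts i))) [0..<Suc l]) = Some s \<and> c s = g t))"
  proof (intro exI[of _ x] exI[of _ g] conjI allI impI)
    fix l n ts \<tau>s t
    assume "\<forall>i<l. n i < n (Suc i)" "\<forall>i\<le>l. \<tau>s i \<in> \<psi>F (map x [0..<n i])"
      and "\<forall>i\<le>l. \<forall>j\<le>l. tree_le par (f (\<tau>s i) (ts i)) (f (\<tau>s j) (ts j)) \<or>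
                        tree_le par (f (\<tau>s j) (ts j)) (f (\<tau>s i) (ts i))"
      and t: "\<exists>i\<le>l. t = f (\<tau>s i) (ts i)" "\<forall>i\<le>l. tree_le par t (f (\<tau>s i) (ts i))"
    then obtain s u where s: "psum add (map (\<lambda>i. \<tau>s i (x (n i) (ts i))) [0..<Suc l]) = Some s"
        "(s, u) \<in> D (Suc (n l))"
      and u: "\<exists>i\<le>l. u = f (\<tau>s i) (ts i)" "\<forall>i\<le>l. tree_le par u (f (\<tau>s i) (ts i))"
      using sums[of l n \<tau>s ts] unfolding comparable_def by blast
    \<comment> \<open>The least element of a chain is unique, so the recorded minimum is
      \<open>t\<close>.\<close>
    have "u = t"
      using tree_le_antisym[OF tree] t u by metis
    then show "\<exists>s. psum add (map (\<lambda>i. \<tau>s i (x (n i) (ts i))) [0..<Suc l]) = Some s \<and> c s = g t"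
      using s colour by blast
  qed (use x in blast)
qed

end

text \<open>An equivariant family of ultrafilters gives both Ramsey statements; the infinitary one
  implies the finitary one, which leads back to such a family. There \<open>coherent_spines\<close>
  yields equivariance of the limit: either the identity acts with identity spine, or spines
  compose.\<close>

theorem theorem3p4:
  fixes r :: "'t::finite" and par :: "'t \<Rightarrow> 't"
    and add :: "'s \<Rightarrow> 's \<Rightarrow> 's option"
    and St :: "'t \<Rightarrow> 's set"
    and F :: "('s \<Rightarrow> 's) set"
    and f :: "('s \<Rightarrow> 's) \<Rightarrow> 't \<Rightarrow> 't"
  assumes "rooted_tree r par"
    and "adequate UNIV add"
    and "tree_action par add St F f"
    and "\<forall>\<tau>\<in>F. regressive_hom par (f \<tau>)"
    and coherent_spines: "(id \<in> F \<and> f id = id) \<or> (\<forall>\<sigma>\<in>F. \<forall>\<tau>\<in>F. f (\<sigma> \<circ> \<tau>) = f \<sigma> \<circ> f \<tau>)"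
  shows "(ramsey_action par add St F f \<longleftrightarrow> gamma_action add St F f \<noteq> {}) \<and>
         (gamma_action add St F f \<noteq> {} \<longleftrightarrow> infinitary_ramsey par add St F f)"
proof -
  interpret regressive_tree_action r par add St F f
    using assms by unfold_locales auto
  show ?thesis
    using gamma_imp_ramsey ramsey_imp_gamma[OF _ coherent_spines] gamma_imp_infinitary
      infinitary_imp_ramsey by blast
qed

end
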